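(* Let $k$ be a field of characteristic $p>0$, let $R=k[x_1,\dots,x_d]$ be the polynomial ring in $d$ variables, and let $\mathcal{D}_R$ be the ring of $k$-linear differential operators of $R$. Let $f\in R$ be a non-zero polynomial. Then $R[\frac{1}{f}]$ is generated by $\frac{1}{f}$ as a $\mathcal{D}_R$-module, i.e. $\mathcal{D}_R\cdot\frac{1}{f}=R[\frac{1}{f}]$.
   Context: $\mathcal{D}_R$ is the ring of $k$-linear differential operators on $R$. Explicitly, it is the subring of $\operatorname{End}_k(R)$ generated by (multiplications by elements of) $R$ and the operators $D_{t,i}=\frac{1}{t!}\frac{\partial^t}{\partial x_i^t}$ for $t\in\mathbb{N}=\{0,1,2,\dots\}$ and $i=1,\dots,d$, where $D_{t,i}$ is the $k$-linear map sending a monomial $x_1^{s_1}\cdots x_d^{s_d}$ to $\binom{s_i}{t}\,x_1^{s_1}\cdots x_i^{s_i-t}\cdots x_d^{s_d}$ (interpreted as $0$ if $s_i<t$). The natural action of $\mathcal{D}_R$ on $R$ extends uniquely to an action on the localization $R[\frac{1}{f}]$ (the standard quotient rule): $R$ acts by multiplication, and the $D_{t,i}$ satisfy the Leibniz rule $D_{t,i}(gh)=\sum_{a+b=t}D_{a,i}(g)D_{b,i}(h)$ for all $g,h\in R[\frac{1}{f}]$. This is the $\mathcal{D}_R$-module structure on $R[\frac{1}{f}]$. $\mathcal{D}_R\cdot\frac1f$ denotes the $\mathcal{D}_R$-submodule generated by $\frac1f$. *)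

theory Defs
  imports
    "HOL-Library.Poly_Mapping"
    "HOL-Computational_Algebra.Computational_Algebra"
begin

section \<open>The polynomial ring and its differential operators\<close>

text \<open>
  A polynomial in countably many variables, indexed by naturals, is a finitely supported map
  from exponent vectors to coefficients.  The ring \<open>k[x\<^sub>1,\<dots>,x\<^sub>d]\<close> is the subring of
  those polynomials in which only the variables with index below \<open>d\<close> occur, so the variable
  \<open>x\<^sub>i\<close> has index \<open>i - 1\<close>.
\<close>

type_synonym 'k mpol = "(nat \<Rightarrow>\<^sub>0 nat) \<Rightarrow>\<^sub>0 'k"

definition poly_ring :: "nat \<Rightarrow> 'k::field mpol set"
  where "poly_ring d = {g. \<forall>s \<in> Poly_Mapping.keys g. Poly_Mapping.keys s \<subseteq> {..<d}}"

text \<open>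
  The operator \<open>D\<^bsub>t,i\<^esub>\<close>.  Subtraction of exponents is truncated, but the binomial
  coefficient vanishes whenever truncation happens.
\<close>

definition hasse :: "nat \<Rightarrow> nat \<Rightarrow> 'k::field mpol \<Rightarrow> 'k mpol"
  where "hasse t i g =
    (\<Sum>s \<in> Poly_Mapping.keys g. Poly_Mapping.single (s - Poly_Mapping.single i t)
                      (of_nat (Poly_Mapping.lookup s i choose t) * Poly_Mapping.lookup g s))"

text \<open>
  Operators on \<open>poly_ring d\<close> are represented by functions on the ambient type that vanish
  outside \<open>poly_ring d\<close>; thus equality of functions is equality of operators.
\<close>

definition on_ring :: "nat \<Rightarrow> ('k::field mpol \<Rightarrow> 'k mpol) \<Rightarrow> 'k mpol \<Rightarrow> 'k mpol"
  where "on_ring d P = (\<lambda>g. if g \<in> poly_ring d then P g else 0)"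

text \<open>
  The subring generated by the multiplications and the \<open>D\<^bsub>t,i\<^esub>\<close>.  The identity and the
  additive inverses come from the multiplications by \<open>1\<close> and \<open>-1\<close>.
\<close>

inductive_set diff_ops :: "nat \<Rightarrow> ('k::field mpol \<Rightarrow> 'k mpol) set" for d where
  mult: "r \<in> poly_ring d \<Longrightarrow> on_ring d ((*) r) \<in> diff_ops d"
| hasse: "i < d \<Longrightarrow> on_ring d (hasse t i) \<in> diff_ops d"
| add: "P \<in> diff_ops d \<Longrightarrow> Q \<in> diff_ops d \<Longrightarrow> (\<lambda>g. P g + Q g) \<in> diff_ops d"
| comp: "P \<in> diff_ops d \<Longrightarrow> Q \<in> diff_ops d \<Longrightarrow> P \<circ> Q \<in> diff_ops d"


section \<open>The localization and its module structure\<close>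

definition embed :: "'k::field mpol \<Rightarrow> 'k mpol fract"
  where "embed g = Fract g 1"

definition localization :: "nat \<Rightarrow> 'k::field mpol \<Rightarrow> 'k mpol fract set"
  where "localization d f = {Fract g (f ^ n) | g n. g \<in> poly_ring d}"

text \<open>
  \<open>act\<close> makes \<open>R[1/f]\<close> a module over the ring of differential operators of \<open>R\<close>,
  extends the action on \<open>R\<close>, lets \<open>R\<close> act by multiplication, and satisfies the Leibniz rule
  for the \<open>D\<^bsub>t,i\<^esub>\<close>.
\<close>

definition natural_action ::
  "nat \<Rightarrow> 'k::field mpol \<Rightarrow> (('k mpol \<Rightarrow> 'k mpol) \<Rightarrow> 'k mpol fract \<Rightarrow> 'k mpol fract) \<Rightarrow> bool"
  where "natural_action d f act \<longleftrightarrow>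
    (\<forall>P \<in> diff_ops d. \<forall>m \<in> localization d f. act P m \<in> localization d f) \<and>
    (\<forall>P \<in> diff_ops d. \<forall>m \<in> localization d f. \<forall>n \<in> localization d f.
        act P (m + n) = act P m + act P n) \<and>
    (\<forall>P \<in> diff_ops d. \<forall>Q \<in> diff_ops d. \<forall>m \<in> localization d f.
        act (\<lambda>g. P g + Q g) m = act P m + act Q m) \<and>
    (\<forall>P \<in> diff_ops d. \<forall>Q \<in> diff_ops d. \<forall>m \<in> localization d f.
        act (P \<circ> Q) m = act P (act Q m)) \<and>
    (\<forall>P \<in> diff_ops d. \<forall>g \<in> poly_ring d. act P (embed g) = embed (P g)) \<and>
    (\<forall>r \<in> poly_ring d. \<forall>m \<in> localization d f. act (on_ring d ((*) r)) m = embed r * m) \<and>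
    (\<forall>i<d. \<forall>t. \<forall>m \<in> localization d f. \<forall>n \<in> localization d f.
        act (on_ring d (hasse t i)) (m * n) =
          (\<Sum>a\<le>t. act (on_ring d (hasse a i)) m * act (on_ring d (hasse (t - a) i)) n))"

text \<open>
  Existence and uniqueness are \<open>natural_action_diff_action\<close> and \<open>natural_action_unique\<close> below.
\<close>

definition diff_action ::
  "nat \<Rightarrow> 'k::field mpol \<Rightarrow> ('k mpol \<Rightarrow> 'k mpol) \<Rightarrow> 'k mpol fract \<Rightarrow> 'k mpol fract"
  where "diff_action d f = (SOME act. natural_action d f act)"

definition diff_submodule :: "nat \<Rightarrow> 'k::field mpol \<Rightarrow> 'k mpol fract set \<Rightarrow> bool"
  where "diff_submodule d f N \<longleftrightarrow>
    N \<subseteq> localization d f \<and> 0 \<in> N \<and> (\<forall>m \<in> N. \<forall>n \<in> N. m + n \<in> N) \<and>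
    (\<forall>P \<in> diff_ops d. \<forall>m \<in> N. diff_action d f P m \<in> N)"

definition generated_submodule :: "nat \<Rightarrow> 'k::field mpol \<Rightarrow> 'k mpol fract set \<Rightarrow> 'k mpol fract set"
  where "generated_submodule d f S = diff_submodule d f hull S"


section \<open>Existence and uniqueness of the module structure\<close>

subsection \<open>The polynomial ring\<close>

lemma poly_ring_0 [simp]: "0 \<in> poly_ring d"
  and poly_ring_1 [simp]: "1 \<in> poly_ring d"
  by (auto simp: poly_ring_def)

lemma poly_ring_add: "g \<in> poly_ring d \<Longrightarrow> h \<in> poly_ring d \<Longrightarrow> g + h \<in> poly_ring d"
  using keys_add[of g h] by (auto simp: poly_ring_def)

lemma poly_ring_uminus: "g \<in> poly_ring d \<Longrightarrow> - g \<in> poly_ring d"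
  by (auto simp: poly_ring_def in_keys_iff)

lemma poly_ring_mult:
  assumes "g \<in> poly_ring d" "h \<in> poly_ring d"
  shows "g * h \<in> poly_ring d"
proof -
  have "Poly_Mapping.keys s \<subseteq> {..<d}" if s: "s \<in> Poly_Mapping.keys (g * h)" for s
  proof -
    obtain a b where ab: "s = a + b" "a \<in> Poly_Mapping.keys g" "b \<in> Poly_Mapping.keys h"
      using s keys_mult[of g h] by blast
    then show ?thesis
      using assms keys_add[of a b] unfolding poly_ring_def by blast
  qed
  then show ?thesis by (auto simp: poly_ring_def)
qed

lemma poly_ring_power: "g \<in> poly_ring d \<Longrightarrow> g ^ n \<in> poly_ring d"
  by (induction n) (auto intro: poly_ring_mult)

lemma poly_ring_sum: "(\<And>x. x \<in> A \<Longrightarrow> g x \<in> poly_ring d) \<Longrightarrow> sum g A \<in> poly_ring d"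
  by (induction A rule: infinite_finite_induct) (auto intro: poly_ring_add)

lemma hasse_closed:
  assumes "g \<in> poly_ring d"
  shows "hasse t i g \<in> poly_ring d"
  unfolding hasse_def
proof (rule poly_ring_sum)
  fix s assume s: "s \<in> Poly_Mapping.keys g"
  have "Poly_Mapping.keys (s - Poly_Mapping.single i t) \<subseteq> Poly_Mapping.keys s"
    by (auto simp: in_keys_iff lookup_minus)
  then show "Poly_Mapping.single (s - Poly_Mapping.single i t)
      (of_nat (Poly_Mapping.lookup s i choose t) * Poly_Mapping.lookup g s) \<in> poly_ring d"
    using s assms by (auto simp: poly_ring_def)
qed

lemma hasse_superset:
  assumes "finite S" "Poly_Mapping.keys g \<subseteq> S"
  shows "hasse t i g = (\<Sum>s\<in>S. Poly_Mapping.single (s - Poly_Mapping.single i t)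
                      (of_nat (Poly_Mapping.lookup s i choose t) * Poly_Mapping.lookup g s))"
  unfolding hasse_def
  by (rule sum.mono_neutral_left) (use assms in \<open>auto simp: in_keys_iff\<close>)

lemma hasse_add: "hasse t i (g + h) = hasse t i g + hasse t i h"
proof -
  let ?S = "Poly_Mapping.keys g \<union> Poly_Mapping.keys h"
  have "Poly_Mapping.keys (g + h) \<subseteq> ?S" by (rule keys_add)
  then show ?thesis
    by (simp add: hasse_superset[of ?S] lookup_add algebra_simps single_add sum.distrib)
qed

lemma hasse_0 [simp]: "hasse t i 0 = 0"
  by (simp add: hasse_def)

lemma hasse_sum: "hasse t i (sum g A) = (\<Sum>x\<in>A. hasse t i (g x))"
  by (induction A rule: infinite_finite_induct) (auto simp: hasse_add)

lemma hasse_single: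
  "hasse t i (Poly_Mapping.single s c) =
     Poly_Mapping.single (s - Poly_Mapping.single i t) (of_nat (Poly_Mapping.lookup s i choose t) * c)"
  by (subst hasse_superset[of "{s}"]) auto

lemma mpol_expand: "(g :: 'k::field mpol) = (\<Sum>s\<in>Poly_Mapping.keys g. Poly_Mapping.single s (Poly_Mapping.lookup g s))"
proof (rule poly_mapping_eqI)
  fix k
  have "(\<Sum>s\<in>Poly_Mapping.keys g. Poly_Mapping.lookup (Poly_Mapping.single s (Poly_Mapping.lookup g s)) k) =
        (\<Sum>s\<in>Poly_Mapping.keys g. if s = k then Poly_Mapping.lookup g k else 0)"
    by (intro sum.cong) (auto simp: lookup_single when_def)
  also have "\<dots> = Poly_Mapping.lookup g k" by (simp add: sum.delta in_keys_iff)
  finally show "Poly_Mapping.lookup g k = Poly_Mapping.lookup (\<Sum>s\<in>Poly_Mapping.keys g. Poly_Mapping.single s (Poly_Mapping.lookup g s)) k"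
    by (simp add: lookup_sum)
qed

lemma hasse_order_0: "hasse 0 i g = g"
  unfolding hasse_def by (simp flip: mpol_expand)

lemma hasse_single_mult:
  fixes b c :: "'k::field"
  shows "hasse t i (Poly_Mapping.single s b * Poly_Mapping.single u c) =
    (\<Sum>a\<le>t. hasse a i (Poly_Mapping.single s b) * hasse (t - a) i (Poly_Mapping.single u c))"
proof -
  let ?e = "\<lambda>t. Poly_Mapping.single i (t::nat)"
  let ?S = "\<lambda>n. Poly_Mapping.single (s + u - ?e t) (of_nat n * (b * c))"
  have "hasse a i (Poly_Mapping.single s b) * hasse (t - a) i (Poly_Mapping.single u c) =
      ?S ((Poly_Mapping.lookup s i choose a) * (Poly_Mapping.lookup u i choose (t - a)))" if "a \<le> t" for a
  proof (cases "a \<le> Poly_Mapping.lookup s i \<and> t - a \<le> Poly_Mapping.lookup u i")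
    case True
    have "(s - ?e a) + (u - ?e (t - a)) = s + u - ?e t"
      by (rule poly_mapping_eqI)
         (use True that in \<open>auto simp: lookup_add lookup_minus lookup_single when_def\<close>)
    then show ?thesis by (simp add: hasse_single mult_single mult_ac)
  next
    case False
    then show ?thesis by (auto simp: hasse_single binomial_eq_0)
  qed
  then have "(\<Sum>a\<le>t. hasse a i (Poly_Mapping.single s b) * hasse (t - a) i (Poly_Mapping.single u c))
      = (\<Sum>a\<le>t. ?S ((Poly_Mapping.lookup s i choose a) * (Poly_Mapping.lookup u i choose (t - a))))"
    by (intro sum.cong) auto
  also have "\<dots> = ?S (\<Sum>a\<le>t. (Poly_Mapping.lookup s i choose a) * (Poly_Mapping.lookup u i choose (t - a)))"
  proof -
    have "(\<Sum>a\<in>A. ?S (h a)) = ?S (\<Sum>a\<in>A. h a)" if "finite A" for A and h :: "nat \<Rightarrow> nat"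
      using that by induction (simp_all add: ring_distribs flip: single_add)
    from this[OF finite_atMost] show ?thesis .
  qed
  also have "\<dots> = hasse t i (Poly_Mapping.single s b * Poly_Mapping.single u c)"
    by (simp only: mult_single hasse_single lookup_add vandermonde)
  finally show ?thesis ..
qed

lemma hasse_mult: "hasse t i (g * h) = (\<Sum>a\<le>t. hasse a i g * hasse (t - a) i h)"
proof -
  let ?G = "\<lambda>s. Poly_Mapping.single s (Poly_Mapping.lookup g s)"
  let ?H = "\<lambda>s. Poly_Mapping.single s (Poly_Mapping.lookup h s)"
  have "hasse t i (g * h) = hasse t i (sum ?G (Poly_Mapping.keys g) * sum ?H (Poly_Mapping.keys h))"
    by (simp flip: mpol_expand)
  also have "\<dots> = (\<Sum>s\<in>Poly_Mapping.keys g. \<Sum>u\<in>Poly_Mapping.keys h. \<Sum>a\<le>t. hasse a i (?G s) * hasse (t - a) i (?H u))"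
    by (simp add: sum_product hasse_sum hasse_single_mult)
  also have "\<dots> = (\<Sum>s\<in>Poly_Mapping.keys g. \<Sum>a\<le>t. \<Sum>u\<in>Poly_Mapping.keys h. hasse a i (?G s) * hasse (t - a) i (?H u))"
    by (intro sum.cong refl sum.swap)
  also have "\<dots> = (\<Sum>a\<le>t. \<Sum>s\<in>Poly_Mapping.keys g. \<Sum>u\<in>Poly_Mapping.keys h. hasse a i (?G s) * hasse (t - a) i (?H u))"
    by (rule sum.swap)
  also have "\<dots> = (\<Sum>a\<le>t. hasse a i (sum ?G (Poly_Mapping.keys g)) * hasse (t - a) i (sum ?H (Poly_Mapping.keys h)))"
    by (simp add: hasse_sum sum_product)
  finally show ?thesis by (simp flip: mpol_expand)
qed

subsection \<open>Extension of the generators to the fraction field\<close>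

lemma embed_add: "embed (g + h) = embed g + embed h"
  and embed_mult: "embed (g * h) = embed g * embed h"
  by (simp_all add: embed_def)

lemma embed_0: "embed 0 = 0" and embed_1: "embed 1 = 1"
  by (simp_all add: embed_def fract_collapse)

lemma embed_sum: "embed (sum g A) = (\<Sum>x\<in>A. embed (g x))"
  by (induction A rule: infinite_finite_induct) (simp_all add: embed_0 embed_add)

lemma embed_power: "embed (g ^ n) = embed g ^ n"
  by (induction n) (simp_all add: embed_1 embed_mult)

lemma embed_eq_iff: "embed g = embed h \<longleftrightarrow> g = h"
  by (simp add: embed_def eq_fract)

lemma embed_eq_0_iff: "embed g = 0 \<longleftrightarrow> g = 0"
  using embed_eq_iff[of g 0] by (simp add: embed_0)

lemma Fract_conv: "Fract g h = embed g / embed h"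
  by (simp add: embed_def)

definition taylor :: "nat \<Rightarrow> 'k::field mpol \<Rightarrow> 'k mpol fract fps"
  where "taylor i g = Abs_fps (\<lambda>t. embed (hasse t i g))"

lemma taylor_nth: "fps_nth (taylor i g) t = embed (hasse t i g)"
  by (simp add: taylor_def)

lemma taylor_add: "taylor i (g + h) = taylor i g + taylor i h"
  by (rule fps_ext) (simp add: taylor_nth hasse_add embed_add)

lemma taylor_mult: "taylor i (g * h) = taylor i g * taylor i h"
  by (rule fps_ext)
     (simp add: taylor_nth hasse_mult embed_sum embed_mult fps_mult_nth atLeast0AtMost)

lemma taylor_eq_0_iff: "taylor i g = 0 \<longleftrightarrow> g = 0"
proof
  assume "taylor i g = 0"
  then have "fps_nth (taylor i g) 0 = 0" by simp
  then show "g = 0" by (simp add: taylor_nth hasse_order_0 embed_eq_0_iff)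
qed (auto intro!: fps_ext simp: taylor_nth embed_0)

lemma taylor_inverse: "h \<noteq> 0 \<Longrightarrow> taylor i h * inverse (taylor i h) = 1"
  by (subst mult.commute, rule inverse_mult_eq_1)
     (simp add: taylor_nth hasse_order_0 embed_eq_0_iff)

definition taylor_frac :: "nat \<Rightarrow> 'k::field mpol fract \<Rightarrow> 'k mpol fract fps"
  where "taylor_frac i q =
    (SOME F. \<exists>a b. b \<noteq> 0 \<and> q = Fract a b \<and> F = taylor i a * inverse (taylor i b))"

lemma taylor_frac_Fract:
  assumes "b \<noteq> 0"
  shows "taylor_frac i (Fract a b) * taylor i b = taylor i a"
proof -
  have "\<exists>a' b'. b' \<noteq> 0 \<and> Fract a b = Fract a' b' \<and>
      taylor_frac i (Fract a b) = taylor i a' * inverse (taylor i b')"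
    unfolding taylor_frac_def by (rule someI_ex) (use assms in blast)
  then obtain a' b' where *: "b' \<noteq> 0" "Fract a b = Fract a' b'"
      "taylor_frac i (Fract a b) = taylor i a' * inverse (taylor i b')" by blast
  have "a * b' = a' * b" using * assms by (simp add: eq_fract)
  then have eq: "taylor i a * taylor i b' = taylor i a' * taylor i b" by (simp flip: taylor_mult)
  have "taylor_frac i (Fract a b) * taylor i b =
      (taylor i a' * taylor i b) * inverse (taylor i b')"
    by (simp only: *(3) mult_ac)
  also have "\<dots> = taylor i a * (taylor i b' * inverse (taylor i b'))"
    unfolding eq[symmetric] by (rule mult.assoc)
  finally show ?thesis using *(1) by (simp add: taylor_inverse)
qed

lemma taylor_frac_embed: "taylor_frac i (embed g) = taylor i g"
proof -
  have "taylor i (1 :: 'a mpol) * taylor i 1 = taylor i 1"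
    by (metis mult_1 taylor_mult)
  then have "taylor i (1 :: 'a mpol) = 1"
    using taylor_eq_0_iff[of i "1 :: 'a mpol"] by simp
  then show ?thesis using taylor_frac_Fract[of 1 i g] by (simp add: embed_def)
qed

lemma taylor_frac_mult: "taylor_frac i (q * r) = taylor_frac i q * taylor_frac i r"
proof -
  obtain a b where q: "q = Fract a b" "b \<noteq> 0" by (cases q)
  obtain a' b' where r: "r = Fract a' b'" "b' \<noteq> 0" by (cases r)
  have "taylor_frac i (q * r) * taylor i (b * b') = taylor i (a * a')"
    using q r by (simp add: taylor_frac_Fract)
  also have "\<dots> = (taylor_frac i q * taylor i b) * (taylor_frac i r * taylor i b')"
    using q r by (simp add: taylor_frac_Fract taylor_mult)
  also have "\<dots> = (taylor_frac i q * taylor_frac i r) * taylor i (b * b')"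
    by (simp add: taylor_mult mult_ac)
  finally show ?thesis using q r by (simp add: taylor_eq_0_iff)
qed

lemma taylor_frac_add: "taylor_frac i (q + r) = taylor_frac i q + taylor_frac i r"
proof -
  obtain a b where q: "q = Fract a b" "b \<noteq> 0" by (cases q)
  obtain a' b' where r: "r = Fract a' b'" "b' \<noteq> 0" by (cases r)
  have "taylor_frac i (q + r) * taylor i (b * b') = taylor i (a * b' + a' * b)"
    using q r by (simp add: taylor_frac_Fract)
  also have "\<dots> = (taylor_frac i q * taylor i b) * taylor i b' +
      (taylor_frac i r * taylor i b') * taylor i b"
    using q r by (simp add: taylor_frac_Fract taylor_mult taylor_add)
  also have "\<dots> = (taylor_frac i q + taylor_frac i r) * taylor i (b * b')"
    by (simp add: taylor_mult algebra_simps)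
  finally show ?thesis using q r by (simp add: taylor_eq_0_iff)
qed

definition hasse_frac :: "nat \<Rightarrow> nat \<Rightarrow> 'k::field mpol fract \<Rightarrow> 'k mpol fract"
  where "hasse_frac t i q = fps_nth (taylor_frac i q) t"

lemma hasse_frac_embed: "hasse_frac t i (embed g) = embed (hasse t i g)"
  by (simp add: hasse_frac_def taylor_frac_embed taylor_nth)

lemma hasse_frac_add: "hasse_frac t i (q + r) = hasse_frac t i q + hasse_frac t i r"
  by (simp add: hasse_frac_def taylor_frac_add)

lemma hasse_frac_mult:
  "hasse_frac t i (q * r) = (\<Sum>a\<le>t. hasse_frac a i q * hasse_frac (t - a) i r)"
  by (simp add: hasse_frac_def taylor_frac_mult fps_mult_nth atLeast0AtMost)

subsection \<open>The localization\<close>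

context
  fixes d :: nat and f :: "'k::field mpol"
  assumes f: "f \<in> poly_ring d" "f \<noteq> 0"
begin

lemma localization_iff:
  "m \<in> localization d f \<longleftrightarrow> (\<exists>n. \<exists>g \<in> poly_ring d. embed f ^ n * m = embed g)"
proof -
  have "m = Fract g (f ^ n) \<longleftrightarrow> embed f ^ n * m = embed g" for g n
  proof -
    have nz: "embed f ^ n \<noteq> 0" using f by (simp add: embed_eq_0_iff)
    have eq: "Fract g (f ^ n) = embed g / embed f ^ n"
      by (simp only: Fract_conv embed_power)
    show ?thesis unfolding eq nonzero_eq_divide_eq[OF nz] by (simp only: mult.commute)
  qed
  then show ?thesis unfolding localization_def by blast
qed

lemma embed_localization: "g \<in> poly_ring d \<Longrightarrow> embed g \<in> localization d f"
  unfolding localization_iff by (intro exI[of _ 0] bexI[of _ g]) auto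

lemma localization_0: "0 \<in> localization d f"
  using embed_localization[of 0] by (simp add: embed_0)

lemma localization_mult:
  assumes "m \<in> localization d f" "n \<in> localization d f"
  shows "m * n \<in> localization d f"
proof -
  obtain a b g h where *: "g \<in> poly_ring d" "h \<in> poly_ring d"
      "embed f ^ a * m = embed g" "embed f ^ b * n = embed h"
    using assms unfolding localization_iff by blast
  have "embed f ^ (a + b) * (m * n) = (embed f ^ a * m) * (embed f ^ b * n)"
    by (simp only: power_add mult_ac)
  also have "\<dots> = embed (g * h)" by (simp only: * embed_mult)
  finally show ?thesis unfolding localization_iff using * poly_ring_mult by blast
qed

lemma localization_add:
  assumes "m \<in> localization d f" "n \<in> localization d f"
  shows "m + n \<in> localization d f"
proof -
  obtain a b g h where *: "g \<in> poly_ring d" "h \<in> poly_ring d"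
      "embed f ^ a * m = embed g" "embed f ^ b * n = embed h"
    using assms unfolding localization_iff by blast
  have "embed f ^ (a + b) * (m + n) =
      embed f ^ b * (embed f ^ a * m) + embed f ^ a * (embed f ^ b * n)"
    by (simp only: power_add distrib_left distrib_right mult_ac)
  also have "\<dots> = embed (f ^ b * g + f ^ a * h)"
    by (simp only: * embed_mult embed_add embed_power)
  finally have "embed f ^ (a + b) * (m + n) = embed (f ^ b * g + f ^ a * h)" .
  moreover have "f ^ b * g + f ^ a * h \<in> poly_ring d"
    using * f by (intro poly_ring_add poly_ring_mult poly_ring_power)
  ultimately show ?thesis unfolding localization_iff by blast
qed

lemma localization_uminus: "m \<in> localization d f \<Longrightarrow> - m \<in> localization d f"
proof -
  assume "m \<in> localization d f"
  moreover have "embed (- 1) \<in> localization d f"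
    by (rule embed_localization) (simp add: poly_ring_uminus)
  ultimately have "embed (- 1) * m \<in> localization d f" using localization_mult by blast
  moreover have "embed (- 1) = (- 1 :: 'k mpol fract)" by (simp add: embed_def One_fract_def)
  ultimately show ?thesis by simp
qed

lemma localization_sum:
  "(\<And>x. x \<in> A \<Longrightarrow> g x \<in> localization d f) \<Longrightarrow> sum g A \<in> localization d f"
  by (induction A rule: infinite_finite_induct) (auto intro: localization_add localization_0)

lemma localization_divide:
  assumes "embed f * m \<in> localization d f"
  shows "m \<in> localization d f"
proof -
  obtain n g where "embed f ^ n * (embed f * m) = embed g" "g \<in> poly_ring d"
    using assms unfolding localization_iff by blast
  then have "embed f ^ Suc n * m = embed g" by (simp add: mult_ac)
  then show ?thesis unfolding localization_iff using \<open>g \<in> poly_ring d\<close> by blast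
qed

lemma localization_induct [consumes 1, case_names embed step]:
  assumes "m \<in> localization d f"
    and "\<And>g. g \<in> poly_ring d \<Longrightarrow> \<Phi> (embed g)"
    and "\<And>m. m \<in> localization d f \<Longrightarrow> \<Phi> (embed f * m) \<Longrightarrow> \<Phi> m"
  shows "\<Phi> m"
proof -
  obtain n g where "embed f ^ n * m = embed g" "g \<in> poly_ring d"
    using assms(1) unfolding localization_iff by blast
  then show ?thesis using assms(1)
  proof (induction n arbitrary: m)
    case 0
    then show ?case using assms(2)[of g] by simp
  next
    case (Suc n)
    have "\<Phi> (embed f * m)"
      using Suc.prems f
      by (intro Suc.IH localization_mult embed_localization) (simp_all add: mult_ac)
    then show ?case using assms(3) Suc.prems by blast
  qed
qed

text \<open>The value of \<open>D\<^bsub>t,i\<^esub>\<close> at \<open>m\<close> is determined by its value at \<open>f m\<close> and lower orders.\<close>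

lemma leibniz_solve:
  fixes D :: "nat \<Rightarrow> 'k mpol fract \<Rightarrow> 'k mpol fract"
  assumes "D t (embed f * m) = (\<Sum>a\<le>t. D a (embed f) * D (t - a) m)"
    and "D 0 (embed f) = embed f"
  shows "embed f * D t m =
    D t (embed f * m) - (\<Sum>a\<in>{1..t}. D a (embed f) * D (t - a) m)"
proof -
  have "{..t} = insert 0 {1..t}" by auto
  then show ?thesis using assms by simp
qed

lemma hasse_frac_closed:
  assumes "m \<in> localization d f"
  shows "hasse_frac t i m \<in> localization d f"
  using assms
proof (induction m arbitrary: t rule: localization_induct)
  case (embed g)
  then show ?case by (simp add: hasse_frac_embed embed_localization hasse_closed)
next
  case (step m)
  show ?case
  proof (induction t rule: less_induct)
    case (less t)
    have "embed f * hasse_frac t i m = hasse_frac t i (embed f * m)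
        - (\<Sum>a\<in>{1..t}. hasse_frac a i (embed f) * hasse_frac (t - a) i m)"
      by (rule leibniz_solve[of "\<lambda>t. hasse_frac t i"])
         (simp_all only: hasse_frac_mult hasse_frac_embed hasse_order_0)
    moreover have "hasse_frac a i (embed f) * hasse_frac (t - a) i m \<in> localization d f"
      if "a \<in> {1..t}" for a
      using that less f
      by (intro localization_mult) (auto simp: hasse_frac_embed intro!: embed_localization hasse_closed)
    ultimately have "embed f * hasse_frac t i m \<in> localization d f"
      unfolding diff_conv_add_uminus
      by (simp only:) (intro localization_add localization_sum localization_uminus step(2))
    then show ?case by (rule localization_divide)
  qed
qed

end

subsection \<open>Extension of all differential operators\<close>

inductive extends :: "nat \<Rightarrow> ('k::field mpol \<Rightarrow> 'k mpol) \<Rightarrow> ('k mpol fract \<Rightarrow> 'k mpol fract) \<Rightarrow> bool"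
  for d where
  mult: "r \<in> poly_ring d \<Longrightarrow> extends d (on_ring d ((*) r)) ((*) (embed r))"
| hasse: "i < d \<Longrightarrow> extends d (on_ring d (hasse t i)) (hasse_frac t i)"
| add: "extends d P P' \<Longrightarrow> extends d Q Q' \<Longrightarrow> extends d (\<lambda>g. P g + Q g) (\<lambda>m. P' m + Q' m)"
| comp: "extends d P P' \<Longrightarrow> extends d Q Q' \<Longrightarrow> extends d (P \<circ> Q) (P' \<circ> Q')"

lemma extends_exists: "P \<in> diff_ops d \<Longrightarrow> \<exists>P'. extends d P P'"
  by (induction rule: diff_ops.induct) (blast intro: extends.intros)+

lemma extends_additive: "extends d P P' \<Longrightarrow> P' (m + n) = P' m + P' n"
  by (induction arbitrary: m n rule: extends.induct)
     (simp_all add: distrib_left hasse_frac_add)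

lemma diff_ops_closed: "P \<in> diff_ops d \<Longrightarrow> g \<in> poly_ring d \<Longrightarrow> P g \<in> poly_ring d"
  by (induction arbitrary: g rule: diff_ops.induct)
     (auto simp: on_ring_def intro: poly_ring_mult poly_ring_add hasse_closed)

lemma extends_embed: "extends d P P' \<Longrightarrow> g \<in> poly_ring d \<Longrightarrow> P g \<in> poly_ring d \<and> P' (embed g) = embed (P g)"
  by (induction arbitrary: g rule: extends.induct)
     (auto simp: on_ring_def hasse_frac_embed embed_add embed_mult intro: poly_ring_mult poly_ring_add hasse_closed)

lemma extends_closed:
  "extends d P P' \<Longrightarrow> f \<in> poly_ring d \<Longrightarrow> f \<noteq> 0 \<Longrightarrow> m \<in> localization d f \<Longrightarrow>
    P' m \<in> localization d f"
  by (induction arbitrary: m rule: extends.induct)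
     (auto intro: localization_mult localization_add embed_localization hasse_frac_closed)

text \<open>Operators of order less than \<open>n\<close> in the sense of Grothendieck.\<close>

fun order_lt :: "nat \<Rightarrow> ('k::field mpol fract \<Rightarrow> 'k mpol fract) \<Rightarrow> bool" where
  "order_lt 0 Q \<longleftrightarrow> (\<forall>m. Q m = 0)"
| "order_lt (Suc n) Q \<longleftrightarrow> (\<forall>r. order_lt n (\<lambda>m. Q (embed r * m) - embed r * Q m))"

lemma order_lt_zero: "order_lt n (\<lambda>m. 0)"
  by (induction n) auto

lemma order_lt_Suc: "order_lt n Q \<Longrightarrow> order_lt (Suc n) Q"
proof (induction n arbitrary: Q)
  case 0
  then show ?case by simp
next
  case (Suc n)
  then have "order_lt (Suc n) (\<lambda>m. Q (embed r * m) - embed r * Q m)" for r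
    by (intro Suc.IH) simp
  then show ?case by (simp only: order_lt.simps(2)[of "Suc n"]) blast
qed

lemma order_lt_mono: "order_lt n Q \<Longrightarrow> n \<le> k \<Longrightarrow> order_lt k Q"
  by (rotate_tac, induction k rule: dec_induct) (auto intro: order_lt_Suc simp del: order_lt.simps)

lemma order_lt_add: "order_lt n P \<Longrightarrow> order_lt n Q \<Longrightarrow> order_lt n (\<lambda>m. P m + Q m)"
proof (induction n arbitrary: P Q)
  case (Suc n)
  have "order_lt n (\<lambda>m. (P (embed r * m) - embed r * P m) + (Q (embed r * m) - embed r * Q m))" for r
    using Suc by auto
  then show ?case by (simp add: algebra_simps)
qed simp

lemma order_lt_sum: "(\<And>x. x \<in> A \<Longrightarrow> order_lt n (Q x)) \<Longrightarrow> order_lt n (\<lambda>m. \<Sum>x\<in>A. Q x m)"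
  by (induction A rule: infinite_finite_induct) (auto intro: order_lt_zero order_lt_add)

lemma order_lt_scale: "order_lt n Q \<Longrightarrow> order_lt n (\<lambda>m. q * Q m)"
proof (induction n arbitrary: Q)
  case (Suc n)
  have "order_lt n (\<lambda>m. q * (Q (embed r * m) - embed r * Q m))" for r
    using Suc by auto
  then show ?case by (simp add: algebra_simps)
qed simp

lemma order_lt_comp:
  assumes "order_lt a P" "order_lt b Q" and "\<And>m n. P (m + n) = P m + P n"
  shows "order_lt (a + b) (P \<circ> Q)"
  using assms
proof (induction "a + b" arbitrary: a b P Q)
  case 0
  then show ?case by simp
next
  case (Suc k)
  have P0: "P 0 = 0" using Suc.prems(3)[of 0 0] by (metis add.right_neutral add_left_cancel)
  have P_diff: "P (m - n) = P m - P n" for m n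
    using Suc.prems(3)[of "m - n" n] by simp
  show ?case
  proof (cases "a = 0 \<or> b = 0")
    case True
    then have "P \<circ> Q = (\<lambda>m. 0)" using Suc.prems P0 by auto
    then show ?thesis by (simp add: order_lt_zero)
  next
    case False
    then obtain a' b' where ab: "a = Suc a'" "b = Suc b'" by (metis not0_implies_Suc)
    have "order_lt k (\<lambda>m. (P (Q (embed r * m) - embed r * Q m))
        + (P (embed r * Q m) - embed r * P (Q m)))" for r
    proof (rule order_lt_add)
      have "order_lt (a + b') (P \<circ> (\<lambda>m. Q (embed r * m) - embed r * Q m))"
        by (rule Suc.hyps(1)) (use Suc.prems Suc.hyps ab in auto)
      then show "order_lt k (\<lambda>m. P (Q (embed r * m) - embed r * Q m))"
        using Suc.hyps(2) ab by (simp add: o_def)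
      have "order_lt (a' + b) ((\<lambda>m. P (embed r * m) - embed r * P m) \<circ> Q)"
        by (rule Suc.hyps(1)) (use Suc.prems Suc.hyps ab in \<open>auto simp: distrib_left\<close>)
      then show "order_lt k (\<lambda>m. P (embed r * Q m) - embed r * P (Q m))"
        using Suc.hyps(2) ab by (simp add: o_def)
    qed
    then have "order_lt (Suc k) (P \<circ> Q)" by (simp add: P_diff)
    then show ?thesis using Suc.hyps(2) by simp
  qed
qed

lemma order_lt_hasse_frac: "order_lt (Suc t) (hasse_frac t i :: 'k::field mpol fract \<Rightarrow> _)"
proof (induction t rule: less_induct)
  case (less t)
  have "order_lt t (\<lambda>m. hasse_frac t i (embed r * m) - embed r * hasse_frac t i m)"
    for r :: "'k mpol"
  proof -
    have "hasse_frac t i (embed r * m) - embed r * hasse_frac t i m =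
        (\<Sum>a\<in>{1..t}. hasse_frac a i (embed r) * hasse_frac (t - a) i m)" for m
    proof -
      have "{..t} = insert 0 {1..t}" by auto
      then show ?thesis by (simp add: hasse_frac_mult hasse_frac_embed hasse_order_0)
    qed
    moreover have "order_lt t (hasse_frac (t - a) i :: 'k mpol fract \<Rightarrow> _)" if "a \<in> {1..t}" for a
      using that by (intro order_lt_mono[OF less]) auto
    then have "order_lt t (\<lambda>m. \<Sum>a\<in>{1..t}. hasse_frac a i (embed r) * hasse_frac (t - a) i m)"
      by (intro order_lt_sum order_lt_scale)
    ultimately show ?thesis by simp
  qed
  then show ?case by simp
qed

lemma extends_order: "extends d P P' \<Longrightarrow> \<exists>n. order_lt n P'"
proof (induction rule: extends.induct)
  case (mult r)
  have "order_lt 1 ((*) (embed r))" by (simp add: mult_ac)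
  then show ?case ..
next
  case (hasse i t)
  then show ?case using order_lt_hasse_frac by blast
next
  case (add P P' Q Q')
  then obtain a b where "order_lt a P'" "order_lt b Q'" by blast
  then have "order_lt (max a b) (\<lambda>m. P' m + Q' m)"
    by (intro order_lt_add) (auto intro: order_lt_mono)
  then show ?case ..
next
  case (comp P P' Q Q')
  then show ?case using order_lt_comp extends_additive by metis
qed

lemma order_lt_vanish:
  fixes f :: "'k::field mpol"
  assumes "order_lt n Q" "f \<in> poly_ring d" "f \<noteq> 0" "m \<in> localization d f"
    and "\<And>g. g \<in> poly_ring d \<Longrightarrow> Q (embed g) = 0"
  shows "Q m = 0"
  using assms(1,4,5)
proof (induction n arbitrary: Q m)
  case (Suc n)
  have *: "Q (embed f * m) = embed f * Q m" if "m \<in> localization d f" for m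
  proof -
    have "Q (embed f * m) - embed f * Q m = 0"
    proof (rule Suc.IH[of "\<lambda>m. Q (embed f * m) - embed f * Q m"])
      show "order_lt n (\<lambda>m. Q (embed f * m) - embed f * Q m)" using Suc.prems(1) by simp
    next
      fix g :: "'k mpol" assume g: "g \<in> poly_ring d"
      have "Q (embed (f * g)) = 0"
        by (rule Suc.prems(3)[OF poly_ring_mult[OF assms(2) g]])
      then show "Q (embed f * embed g) - embed f * Q (embed g) = 0"
        using Suc.prems(3)[OF g] by (simp only: embed_mult) simp
    qed fact
    then show ?thesis by simp
  qed
  show ?case
    using Suc.prems(2)
  proof (induction m rule: localization_induct[OF assms(2,3), consumes 1, case_names embed step])
    case (embed g)
    then show ?case by (rule Suc.prems(3))
  next
    case (step m)
    then show ?case using *[of m] assms(3) by (simp add: embed_eq_0_iff)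
  qed
qed simp

lemma extends_unique:
  assumes "extends d P Q" "extends d P Q'"
    and f: "f \<in> poly_ring d" "f \<noteq> 0" "m \<in> localization d f"
  shows "Q m = Q' m"
proof -
  let ?D = "\<lambda>m. Q m + (-1) * Q' m"
  obtain a b where "order_lt a Q" "order_lt b Q'" using assms extends_order by blast
  then have "order_lt (max a b) ?D"
    by (intro order_lt_add order_lt_scale) (auto intro: order_lt_mono)
  then have "?D m = 0"
    by (rule order_lt_vanish[OF _ f])
       (use extends_embed[OF assms(1)] extends_embed[OF assms(2)] in simp)
  then show ?thesis by simp
qed

lemma natural_action_exists:
  fixes f :: "'k::field mpol"
  assumes f: "f \<in> poly_ring d" "f \<noteq> 0"
  shows "\<exists>act. natural_action d f act"
proof -
  define act :: "('k mpol \<Rightarrow> 'k mpol) \<Rightarrow> 'k mpol fract \<Rightarrow> 'k mpol fract"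
    where "act P = (SOME P'. extends d P P')" for P
  have ext: "extends d P (act P)" if "P \<in> diff_ops d" for P
    unfolding act_def by (rule someI_ex[OF extends_exists[OF that]])
  have eq: "act P m = P' m" if "extends d P P'" "m \<in> localization d f" for P P' m
  proof -
    have "extends d P (act P)" unfolding act_def by (rule someI[of "extends d P"]) (rule that(1))
    then show ?thesis using extends_unique that f by blast
  qed
  have closed: "act P m \<in> localization d f" if "P \<in> diff_ops d" "m \<in> localization d f" for P m
    using extends_closed[OF ext f] that by blast
  have comp: "act (P \<circ> Q) m = act P (act Q m)"
    if "P \<in> diff_ops d" "Q \<in> diff_ops d" "m \<in> localization d f" for P Q m
    using eq[OF extends.comp[OF ext ext]] that by simp
  have plus: "act (\<lambda>g. P g + Q g) m = act P m + act Q m"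
    if "P \<in> diff_ops d" "Q \<in> diff_ops d" "m \<in> localization d f" for P Q m
    using eq[OF extends.add[OF ext ext]] that by simp
  have additive: "act P (m + n) = act P m + act P n" if "P \<in> diff_ops d" for P m n
    using ext[OF that] by (rule extends_additive)
  have emb: "act P (embed g) = embed (P g)" if "P \<in> diff_ops d" "g \<in> poly_ring d" for P g
    using extends_embed[OF ext] that by blast
  have mult: "act (on_ring d ((*) r)) m = embed r * m"
    if "r \<in> poly_ring d" "m \<in> localization d f" for r m
    by (rule eq[OF extends.mult]) fact+
  have leib: "act (on_ring d (hasse t i)) (m * n) =
      (\<Sum>a\<le>t. act (on_ring d (hasse a i)) m * act (on_ring d (hasse (t - a) i)) n)"
    if "i < d" "m \<in> localization d f" "n \<in> localization d f" for i t m n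
    using that localization_mult[OF f that(2,3)]
    by (simp only: eq[OF extends.hasse] hasse_frac_mult)
  have "natural_action d f act"
    unfolding natural_action_def
    by (intro conjI ballI allI impI)
       ((rule closed additive plus comp emb mult leib, assumption+)[1])+
  then show ?thesis by (rule exI[of _ act])
qed

theorem natural_action_diff_action:
  "f \<in> poly_ring d \<Longrightarrow> f \<noteq> 0 \<Longrightarrow> natural_action d f (diff_action d f)"
  unfolding diff_action_def by (rule someI_ex[OF natural_action_exists])

lemma natural_actionD:
  assumes "natural_action d f act"
  shows "P \<in> diff_ops d \<Longrightarrow> m \<in> localization d f \<Longrightarrow> act P m \<in> localization d f"
    and "P \<in> diff_ops d \<Longrightarrow> m \<in> localization d f \<Longrightarrow> n \<in> localization d f \<Longrightarrow>
        act P (m + n) = act P m + act P n"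
    and "P \<in> diff_ops d \<Longrightarrow> Q \<in> diff_ops d \<Longrightarrow> m \<in> localization d f \<Longrightarrow>
        act (\<lambda>g. P g + Q g) m = act P m + act Q m"
    and "P \<in> diff_ops d \<Longrightarrow> Q \<in> diff_ops d \<Longrightarrow> m \<in> localization d f \<Longrightarrow>
        act (P \<circ> Q) m = act P (act Q m)"
    and "P \<in> diff_ops d \<Longrightarrow> g \<in> poly_ring d \<Longrightarrow> act P (embed g) = embed (P g)"
    and "r \<in> poly_ring d \<Longrightarrow> m \<in> localization d f \<Longrightarrow> act (on_ring d ((*) r)) m = embed r * m"
    and "i < d \<Longrightarrow> m \<in> localization d f \<Longrightarrow> n \<in> localization d f \<Longrightarrow>
        act (on_ring d (hasse t i)) (m * n) =
          (\<Sum>a\<le>t. act (on_ring d (hasse a i)) m * act (on_ring d (hasse (t - a) i)) n)"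
  by (use assms[unfolded natural_action_def] in \<open>simp_all only: simp_thms Ball_def\<close>)

theorem natural_action_unique:
  assumes f: "f \<in> poly_ring d" "f \<noteq> 0"
    and A: "natural_action d f A" and B: "natural_action d f B"
    and "P \<in> diff_ops d" "m \<in> localization d f"
  shows "A P m = B P m"
  using assms(5,6)
proof (induction arbitrary: m rule: diff_ops.induct)
  case (mult r)
  then show ?case using A B unfolding natural_action_def by simp
next
  case (hasse i t)
  define DA where "DA t = A (on_ring d (Defs.hasse t i))" for t
  define DB where "DB t = B (on_ring d (Defs.hasse t i))" for t
  note ops = diff_ops.hasse[OF hasse(1)]
  have emb: "DA t (embed g) = embed (Defs.hasse t i g)" "DB t (embed g) = embed (Defs.hasse t i g)"
    if "g \<in> poly_ring d" for t g
  proof -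
    have "A P (embed g) = embed (P g)" "B P (embed g) = embed (P g)" if "P \<in> diff_ops d" for P
      using A B that \<open>g \<in> poly_ring d\<close> unfolding natural_action_def by simp_all
    from this[OF ops] show "DA t (embed g) = embed (Defs.hasse t i g)"
        "DB t (embed g) = embed (Defs.hasse t i g)"
      using that by (simp_all add: DA_def DB_def on_ring_def)
  qed
  have leib: "DA t (m * n) = (\<Sum>a\<le>t. DA a m * DA (t - a) n)"
      "DB t (m * n) = (\<Sum>a\<le>t. DB a m * DB (t - a) n)"
    if "m \<in> localization d f" "n \<in> localization d f" for t m n
    using A B hasse(1) that unfolding natural_action_def DA_def DB_def by simp_all
  have "DA t m = DB t m" using hasse(2)
  proof (induction m arbitrary: t rule: localization_induct[OF f, consumes 1, case_names embed step])
    case (embed g)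
    then show ?case by (simp add: emb)
  next
    case (step m)
    note fl = embed_localization[OF f f(1)]
    show ?case
    proof (induction t rule: less_induct)
      case (less t)
      have "embed f * DA t m = DA t (embed f * m) - (\<Sum>a\<in>{1..t}. DA a (embed f) * DA (t - a) m)"
        by (rule leibniz_solve[OF f]) (simp_all only: leib[OF fl step(1)] emb[OF f(1)] hasse_order_0)
      moreover have
        "embed f * DB t m = DB t (embed f * m) - (\<Sum>a\<in>{1..t}. DB a (embed f) * DB (t - a) m)"
        by (rule leibniz_solve[OF f]) (simp_all only: leib[OF fl step(1)] emb[OF f(1)] hasse_order_0)
      moreover have "(\<Sum>a\<in>{1..t}. DA a (embed f) * DA (t - a) m) =
          (\<Sum>a\<in>{1..t}. DB a (embed f) * DB (t - a) m)"
          by (intro sum.cong) (use less emb[OF f(1)] in auto)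
      ultimately have "embed f * DA t m = embed f * DB t m" using step(2)[of t] by simp
      then show ?case using f by (simp add: embed_eq_0_iff)
    qed
  qed
  then show ?case by (simp add: DA_def DB_def)
next
  case (add P Q)
  then show ?case using A B unfolding natural_action_def by simp
next
  case (comp P Q)
  have "A (P \<circ> Q) m = A P (A Q m)" "A Q m \<in> localization d f" "B (P \<circ> Q) m = B P (B Q m)"
    using comp.hyps comp.prems by (simp_all only: natural_actionD[OF A] natural_actionD[OF B])
  then show ?case using comp.IH comp.prems by (simp add: o_def)
qed

end

theory Submission
  imports Defs
begin

text \<open>
  For \<open>q = p^e\<close> write \<open>g = \<Sum> c\<^sub>a x^a\<close> with exponents \<open>a\<close> below \<open>q\<close> and coefficients
  \<open>c\<^sub>a\<close> in the ring of polynomials in the \<open>q\<close>-th powers of the variables.  The operators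
  of order below \<open>q\<close> in each variable commute with \<open>f^q\<close>, and they extract the coefficients, so a
  submodule containing \<open>g / f^q\<close> contains \<open>J\<^sub>q(g) / f^q\<close>, where \<open>J\<^sub>q(g)\<close> is the ideal
  generated by the \<open>c\<^sub>a\<close>.

  For \<open>q = p^L\<close> the ideals \<open>J\<^sub>q(f^(q - p^j))\<close> increase with \<open>j\<close>.  A degree bound on the coefficients,
  uniform in \<open>q\<close>, shows that for \<open>L\<close> large some \<open>f^(q - p^(j+1))\<close> lies in \<open>J\<^sub>q(f^(q - p^j))\<close>.  Taking
  \<open>p^j\<close>-th roots yields an \<open>e\<close> with \<open>f^(p^e - p)\<close> in the ideal of \<open>f^(p^e - 1)\<close>, that is,
  \<open>1/f^p\<close> lies in the submodule generated by \<open>1/f\<close>.  Taking \<open>p^n\<close>-th powers of this membership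
  gives all \<open>1/f^(p^n)\<close> by induction.
\<close>

section \<open>Exponent vectors\<close>

definition escale :: "nat \<Rightarrow> (nat \<Rightarrow>\<^sub>0 nat) \<Rightarrow> (nat \<Rightarrow>\<^sub>0 nat)"
  where "escale q s = Poly_Mapping.map ((*) q) s"

definition ediv :: "nat \<Rightarrow> (nat \<Rightarrow>\<^sub>0 nat) \<Rightarrow> (nat \<Rightarrow>\<^sub>0 nat)"
  where "ediv q s = Poly_Mapping.map (\<lambda>n. n div q) s"

definition emod :: "nat \<Rightarrow> (nat \<Rightarrow>\<^sub>0 nat) \<Rightarrow> (nat \<Rightarrow>\<^sub>0 nat)"
  where "emod q s = Poly_Mapping.map (\<lambda>n. n mod q) s"

lemma lookup_escale [simp]: "Poly_Mapping.lookup (escale q s) i = q * Poly_Mapping.lookup s i"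
  and lookup_ediv [simp]: "Poly_Mapping.lookup (ediv q s) i = Poly_Mapping.lookup s i div q"
  and lookup_emod [simp]: "Poly_Mapping.lookup (emod q s) i = Poly_Mapping.lookup s i mod q"
  by (simp_all add: escale_def ediv_def emod_def map.rep_eq when_def)

lemma keys_escale: "Poly_Mapping.keys (escale q s) \<subseteq> Poly_Mapping.keys s"
  and keys_ediv: "Poly_Mapping.keys (ediv q s) \<subseteq> Poly_Mapping.keys s"
  and keys_emod: "Poly_Mapping.keys (emod q s) \<subseteq> Poly_Mapping.keys s"
  unfolding subset_iff in_keys_iff lookup_escale lookup_ediv lookup_emod
  by (metis mult_0_right div_0 mod_0)+

lemma emod_plus_escale_ediv: "emod q s + escale q (ediv q s) = s"
  by (rule poly_mapping_eqI) (simp add: lookup_add)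

lemma escale_eq_iff: "q > 0 \<Longrightarrow> escale q s = escale q u \<longleftrightarrow> s = u"
  by (auto simp: poly_mapping_eq_iff fun_eq_iff)

lemma escale_escale: "escale q (escale r s) = escale (q * r) s"
  by (rule poly_mapping_eqI) simp

lemma escale_add: "escale q (s + u) = escale q s + escale q u"
  by (rule poly_mapping_eqI) (simp add: lookup_add algebra_simps)

lemma emod_escale_add: "emod q (escale q w + s) = emod q s"
  by (rule poly_mapping_eqI) (simp add: lookup_add)

lemma ediv_escale_add: "q > 0 \<Longrightarrow> ediv q (escale q w + s) = w + ediv q s"
  by (rule poly_mapping_eqI) (simp add: lookup_add)

lemma emod_mult_escale: "emod (q * r) (escale q s) = escale q (emod r s)"
  by (rule poly_mapping_eqI) simp

lemma ediv_mult_escale: "q > 0 \<Longrightarrow> ediv (q * r) (escale q s) = ediv r s"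
  by (rule poly_mapping_eqI) simp

section \<open>Additive maps given on monomials\<close>

lemma mpol_keys_induct [consumes 1, case_names zero single add]:
  fixes g :: "'k::field mpol"
  assumes "Poly_Mapping.keys g \<subseteq> S" and zero: "P 0"
    and single: "\<And>s c. s \<in> S \<Longrightarrow> P (Poly_Mapping.single s c)"
    and add: "\<And>g h. P g \<Longrightarrow> P h \<Longrightarrow> P (g + h)"
  shows "P g"
proof -
  have "P (\<Sum>s\<in>A. Poly_Mapping.single s (Poly_Mapping.lookup g s))" if "A \<subseteq> S" for A
    using that by (induction A rule: infinite_finite_induct) (auto intro: zero single add)
  then show ?thesis using assms(1) by (subst mpol_expand)
qed

lemma mpol_induct [case_names single add]:
  fixes g :: "'k::field mpol"
  assumes "\<And>s c. P (Poly_Mapping.single s c)" "\<And>g h. P g \<Longrightarrow> P h \<Longrightarrow> P (g + h)"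
  shows "P g"
  by (rule mpol_keys_induct[OF subset_UNIV]) (use assms(1)[of _ 0] in \<open>auto intro: assms\<close>)

text \<open>Each \<open>\<phi> s\<close> may be any map on coefficients, because
  \<open>cartier\<close> needs one that is additive but not necessarily
  \<open>k\<close>-linear.\<close>

definition mono_ext :: "((nat \<Rightarrow>\<^sub>0 nat) \<Rightarrow> 'k \<Rightarrow> 'k mpol) \<Rightarrow> 'k::field mpol \<Rightarrow> 'k mpol"
  where "mono_ext \<phi> g = (\<Sum>s\<in>Poly_Mapping.keys g. \<phi> s (Poly_Mapping.lookup g s))"

context
  fixes \<phi> :: "(nat \<Rightarrow>\<^sub>0 nat) \<Rightarrow> 'k::field \<Rightarrow> 'k mpol"
  assumes \<phi>: "\<And>s b c. \<phi> s (b + c) = \<phi> s b + \<phi> s c"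
begin

lemma mono_ext_zero_coeff: "\<phi> s 0 = 0"
  using \<phi>[of s 0 0] by (metis add.right_neutral add_left_cancel)

lemma mono_ext_superset:
  "finite S \<Longrightarrow> Poly_Mapping.keys g \<subseteq> S \<Longrightarrow>
    mono_ext \<phi> g = (\<Sum>s\<in>S. \<phi> s (Poly_Mapping.lookup g s))"
  unfolding mono_ext_def
  by (rule sum.mono_neutral_left) (auto simp: in_keys_iff mono_ext_zero_coeff)

lemma mono_ext_single: "mono_ext \<phi> (Poly_Mapping.single s c) = \<phi> s c"
  by (subst mono_ext_superset[of "{s}"]) auto

lemma mono_ext_add: "mono_ext \<phi> (g + h) = mono_ext \<phi> g + mono_ext \<phi> h"
proof -
  let ?S = "Poly_Mapping.keys g \<union> Poly_Mapping.keys h"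
  show ?thesis
    using keys_add[of g h] by (simp add: mono_ext_superset[of ?S] lookup_add \<phi> sum.distrib)
qed

end

lemma mono_ext_poly_ring:
  assumes "g \<in> poly_ring d"
    and "\<And>s c. Poly_Mapping.keys s \<subseteq> {..<d} \<Longrightarrow> \<phi> s c \<in> poly_ring d"
  shows "mono_ext \<phi> g \<in> poly_ring d"
  unfolding mono_ext_def by (intro poly_ring_sum assms(2)) (use assms(1) in \<open>simp add: poly_ring_def\<close>)

lemma poly_ring_single: "Poly_Mapping.keys s \<subseteq> {..<d} \<Longrightarrow> Poly_Mapping.single s c \<in> poly_ring d"
  by (simp add: poly_ring_def)

section \<open>Coefficients over the ring of polynomials in the \<open>q\<close>-th powers of the variables\<close>

text \<open>For \<open>q > 0\<close> the monomials \<open>x^a\<close> with exponents below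
  \<open>q\<close> form a basis over the subring of polynomials in the \<open>q\<close>-th powers;
  this is a coordinate in that basis. Exponents are not divided by \<open>q\<close>, so it stays in
  the subring.\<close>

definition coef :: "nat \<Rightarrow> (nat \<Rightarrow>\<^sub>0 nat) \<Rightarrow> 'k::field mpol \<Rightarrow> 'k mpol"
  where "coef q a = mono_ext
    (\<lambda>s c. if emod q s = a then Poly_Mapping.single (escale q (ediv q s)) c else 0)"

lemma coef_single: "coef q a (Poly_Mapping.single s c) =
    (if emod q s = a then Poly_Mapping.single (escale q (ediv q s)) c else 0)"
  and coef_add: "coef q a (g + h) = coef q a g + coef q a h"
  unfolding coef_def
  by (subst mono_ext_single mono_ext_add; simp add: single_add)+

lemma coef_0 [simp]: "coef q a 0 = 0"
  by (simp add: coef_def mono_ext_def)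

lemma coef_poly_ring: "g \<in> poly_ring d \<Longrightarrow> coef q a g \<in> poly_ring d"
  unfolding coef_def
  by (rule mono_ext_poly_ring)
     (auto intro!: poly_ring_single dest!: subsetD[OF keys_escale] subsetD[OF keys_ediv])

lemma keys_coef:
  assumes "u \<in> Poly_Mapping.keys (coef q a g)"
  obtains s where "s \<in> Poly_Mapping.keys g" "u = escale q (ediv q s)"
proof -
  let ?\<phi> = "\<lambda>s. if emod q s = a then Poly_Mapping.single (escale q (ediv q s)) (Poly_Mapping.lookup g s) else 0"
  have "(\<Sum>s\<in>Poly_Mapping.keys g. Poly_Mapping.lookup (?\<phi> s) u) \<noteq> 0"
    using assms unfolding coef_def mono_ext_def in_keys_iff lookup_sum .
  then obtain s where "s \<in> Poly_Mapping.keys g" "Poly_Mapping.lookup (?\<phi> s) u \<noteq> 0"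
    by (rule sum.not_neutral_contains_not_neutral)
  then show ?thesis using that by (auto simp: lookup_single when_def split: if_splits)
qed

lemma coef_expand:
  fixes g :: "'k::field mpol"
  assumes A: "finite A" "emod q ` Poly_Mapping.keys g \<subseteq> A"
  shows "g = (\<Sum>a\<in>A. Poly_Mapping.single a 1 * coef q a g)"
proof -
  let ?m = "\<lambda>s. Poly_Mapping.single s (Poly_Mapping.lookup g s)"
  have "(\<Sum>a\<in>A. Poly_Mapping.single a 1 * coef q a g) =
      (\<Sum>s\<in>Poly_Mapping.keys g. \<Sum>a\<in>A. if emod q s = a then
        Poly_Mapping.single a 1 * Poly_Mapping.single (escale q (ediv q s)) (Poly_Mapping.lookup g s) else 0)"
    unfolding coef_def mono_ext_def sum_distrib_left by (subst sum.swap) (auto intro!: sum.cong)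
  also have "\<dots> = (\<Sum>s\<in>Poly_Mapping.keys g. ?m s)"
    using A by (intro sum.cong) (auto simp: mult_single emod_plus_escale_ediv)
  finally show ?thesis by (simp flip: mpol_expand)
qed

text \<open>Multiplication by a polynomial in the \<open>q\<close>-th powers preserves remainders of
  exponents modulo \<open>q\<close>, so \<open>coef q a\<close> is linear over such polynomials;
  \<open>coef q b h\<close> is a typical one.\<close>

lemma coef_coef_mult:
  assumes "q > 0"
  shows "coef q a (coef q b h * r) = coef q b h * coef q a r"
proof (induction h rule: mpol_induct)
  case (add g h)
  then show ?case by (simp add: coef_add distrib_right)
next
  case (single s c)
  show ?case
  proof (induction r rule: mpol_induct)
    case (add g h)
    then show ?case by (simp add: coef_add distrib_left)
  next
    case (single s' c')
    show ?case using assms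
      by (simp add: coef_single mult_single emod_escale_add ediv_escale_add escale_add)
  qed
qed

section \<open>The ideal of coefficients\<close>

text \<open>If \<open>k\<close> is perfect, \<open>q\<close> a power of its characteristic
  \<open>p > 0\<close> and \<open>g\<close> in \<open>poly_ring d\<close>, this is
  \<open>I^[q]\<close> for the smallest ideal \<open>I\<close> whose Frobenius power
  \<open>I^[q]\<close> contains \<open>g\<close>.\<close>

inductive_set coef_ideal :: "nat \<Rightarrow> nat \<Rightarrow> 'k::field mpol \<Rightarrow> 'k mpol set" for d q g where
  zero: "0 \<in> coef_ideal d q g"
| step: "x \<in> coef_ideal d q g \<Longrightarrow> r \<in> poly_ring d \<Longrightarrow> x + r * coef q a g \<in> coef_ideal d q g"

lemma coef_ideal_coef: "coef q a g \<in> coef_ideal d q g"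
  using coef_ideal.step[OF coef_ideal.zero poly_ring_1, where a = a] by simp

lemma coef_ideal_add:
  "y \<in> coef_ideal d q g \<Longrightarrow> x \<in> coef_ideal d q g \<Longrightarrow> x + y \<in> coef_ideal d q g"
  by (induction y rule: coef_ideal.induct) (auto simp flip: add.assoc intro: coef_ideal.step)

lemma coef_ideal_sum:
  "(\<And>x. x \<in> A \<Longrightarrow> h x \<in> coef_ideal d q g) \<Longrightarrow> sum h A \<in> coef_ideal d q g"
  by (induction A rule: infinite_finite_induct) (auto intro: coef_ideal_add coef_ideal.zero)

lemma coef_ideal_mult:
  assumes "x \<in> coef_ideal d q g" "r \<in> poly_ring d"
  shows "r * x \<in> coef_ideal d q g"
  using assms
proof (induction x rule: coef_ideal.induct)
  case (step x r' a)
  have "r * x + (r * r') * coef q a g \<in> coef_ideal d q g"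
    by (intro coef_ideal.step poly_ring_mult step)
  then show ?case by (simp add: distrib_left mult.assoc)
qed (simp add: coef_ideal.zero)

lemma coef_ideal_if_coefs:
  assumes "g \<in> poly_ring d" "\<And>a. coef q a g \<in> coef_ideal d q h"
  shows "g \<in> coef_ideal d q h"
proof -
  have "(\<Sum>a\<in>emod q ` Poly_Mapping.keys g. Poly_Mapping.single a 1 * coef q a g) \<in> coef_ideal d q h"
    using assms
    by (intro coef_ideal_sum coef_ideal_mult) (auto intro!: poly_ring_single dest!: subsetD[OF keys_emod] simp: poly_ring_def)
  also have "(\<Sum>a\<in>emod q ` Poly_Mapping.keys g. Poly_Mapping.single a 1 * coef q a g) = g"
    by (rule coef_expand[symmetric]) auto
  finally show ?thesis .
qed

text \<open>The generators lie in the subring over which \<open>coef q a\<close> is linear, so a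
  multiple of a generator is sent to a multiple of the same generator.\<close>

lemma coef_in_coef_ideal:
  assumes "x \<in> coef_ideal d q g" "q > 0"
  shows "coef q a x \<in> coef_ideal d q g"
  using assms
proof (induction x rule: coef_ideal.induct)
  case (step x r b)
  then have "coef q a x + coef q a r * coef q b g \<in> coef_ideal d q g"
    by (intro coef_ideal.step coef_poly_ring)
  then show ?case
    using coef_coef_mult[OF \<open>q > 0\<close>, of a b g r] by (simp add: coef_add mult.commute)
qed (simp add: coef_ideal.zero)

lemma coef_ideal_subset:
  assumes "g \<in> coef_ideal d q h" "q > 0"
  shows "coef_ideal d q g \<subseteq> coef_ideal d q h"
proof
  fix x assume "x \<in> coef_ideal d q g"
  then show "x \<in> coef_ideal d q h"
    by (induction rule: coef_ideal.induct)
       (auto intro: coef_ideal.zero coef_ideal_add coef_ideal_mult coef_in_coef_ideal assms)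
qed

lemma coef_ideal_self: "g \<in> poly_ring d \<Longrightarrow> g \<in> coef_ideal d q g"
  by (rule coef_ideal_if_coefs) (auto intro: coef_ideal_coef)

section \<open>The Frobenius map\<close>

lemma CHAR_mpol: "CHAR('k::field mpol) = CHAR('k)"
proof (rule CHAR_eqI)
  have "of_nat n = (0 :: 'k mpol) \<longleftrightarrow> of_nat n = (0 :: 'k)" for n
  proof -
    have "of_nat n = (0 :: 'k mpol) \<longleftrightarrow> Poly_Mapping.single 0 (of_nat n) = (0 :: 'k mpol)"
      by (simp only: single_of_nat)
    also have "\<dots> \<longleftrightarrow> of_nat n = (0 :: 'k)"
      by (metis lookup_single_eq lookup_zero single_zero)
    finally show ?thesis .
  qed
  then show "of_nat CHAR('k) = (0 :: 'k mpol)" "\<And>x. of_nat x = (0 :: 'k mpol) \<Longrightarrow> CHAR('k) dvd x"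
    by (auto simp: of_nat_eq_0_iff_char_dvd)
qed

lemma single_power: "Poly_Mapping.single s c ^ n = Poly_Mapping.single (escale n s) (c ^ n :: 'k::field)"
proof (induction n)
  case 0
  have "escale 0 s = 0" by (rule poly_mapping_eqI) simp
  then show ?case by simp
next
  case (Suc n)
  have "s + escale n s = escale (Suc n) s" by (rule poly_mapping_eqI) (simp add: lookup_add)
  then show ?case using Suc by (simp add: mult_single)
qed

context
  assumes CHAR_pos: "CHAR('k::field) > 0"
begin

lemma prime_CHAR: "prime CHAR('k)"
  using CHAR_pos by (simp add: prime_CHAR_semidom)

lemma Frobenius_add: "(g + h :: 'k mpol) ^ (CHAR('k) ^ j) = g ^ (CHAR('k) ^ j) + h ^ (CHAR('k) ^ j)"
  by (rule freshmans_dream') (use prime_CHAR in \<open>simp_all add: CHAR_mpol\<close>)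

lemma Frobenius_add_field: "(b + c :: 'k) ^ (CHAR('k) ^ j) = b ^ (CHAR('k) ^ j) + c ^ (CHAR('k) ^ j)"
  by (rule freshmans_dream') (use prime_CHAR in simp_all)

text \<open>The \<open>Q\<close>-th power is additive, so monomials suffice: the remainder of
  \<open>Q s\<close> modulo \<open>Q q\<close> is \<open>Q\<close> times that of \<open>s\<close>
  modulo \<open>q\<close>.\<close>

lemma coef_Frobenius:
  fixes g :: "'k mpol"
  assumes Q: "Q = CHAR('k) ^ j"
  shows "coef (Q * q) (escale Q a) (g ^ Q) = coef q a g ^ Q"
proof -
  have Q0: "Q > 0" using Q CHAR_pos by simp
  show ?thesis
  proof (induction g rule: mpol_induct)
    case (single s c)
    show ?case using Q0
      by (simp add: coef_single single_power emod_mult_escale ediv_mult_escale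
          escale_eq_iff escale_escale power_0_left)
  qed (simp add: coef_add Frobenius_add Q)
qed

text \<open>Exponents in \<open>g ^ Q\<close> are multiples of \<open>Q\<close>, hence so are their
  remainders modulo \<open>Q * q\<close>.\<close>

lemma coef_Frobenius_eq_0:
  fixes g :: "'k mpol"
  assumes Q: "Q = CHAR('k) ^ j" and "\<And>a. b \<noteq> escale Q a"
  shows "coef (Q * q) b (g ^ Q) = 0"
proof (induction g rule: mpol_induct)
  case (single s c)
  show ?case using assms(2)[of "emod q s"] by (auto simp: coef_single single_power emod_mult_escale)
qed (simp add: coef_add Frobenius_add Q)

lemma Frobenius_coef_ideal:
  fixes g :: "'k mpol"
  assumes Q: "Q = CHAR('k) ^ j" and "x \<in> coef_ideal d q g"
  shows "x ^ Q \<in> coef_ideal d (Q * q) (g ^ Q)"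
  using assms(2)
proof (induction x rule: coef_ideal.induct)
  case zero
  have "Q > 0" using Q CHAR_pos by simp
  then show ?case by (simp add: coef_ideal.zero power_0_left)
next
  case (step x r a)
  then have "x ^ Q + r ^ Q * coef (Q * q) (escale Q a) (g ^ Q) \<in> coef_ideal d (Q * q) (g ^ Q)"
    by (intro coef_ideal.step poly_ring_power)
  moreover have "(x + r * coef q a g) ^ Q = x ^ Q + r ^ Q * coef q a g ^ Q"
    by (simp only: Q Frobenius_add power_mult_distrib)
  ultimately show ?case by (simp only: coef_Frobenius[OF Q])
qed

end

section \<open>Descent along Frobenius\<close>

text \<open>
  A linear form on \<open>k\<close> as a vector space over its \<open>Q\<close>-th powers; it replaces the \<open>Q\<close>-th root,
  which does not exist when \<open>k\<close> is not perfect.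
\<close>

lemma root_form_exists:
  assumes "CHAR('k::field) > 0" and Q: "Q = CHAR('k) ^ j"
  obtains \<tau> :: "'k::field \<Rightarrow> 'k" where "\<And>b c. \<tau> (b + c) = \<tau> b + \<tau> c"
    "\<And>b c. \<tau> (b ^ Q * c) = b * \<tau> c" "\<tau> 1 = 1"
proof -
  \<comment> \<open>Scalars act through their \<open>Q\<close>-th powers on the source and by plain
    multiplication on the target. A linear extension of the identity on \<open>{1}\<close> is then
    the required form.\<close>
  interpret vs: vector_space "\<lambda>b c :: 'k. b ^ Q * c"
    by unfold_locales
       (use Frobenius_add_field[OF assms(1)] Q in \<open>simp_all add: algebra_simps power_mult_distrib\<close>)
  interpret vs': vector_space "(*) :: 'k \<Rightarrow> 'k \<Rightarrow> 'k"
    by unfold_locales (simp_all add: algebra_simps)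
  interpret pair: vector_space_pair "\<lambda>b c :: 'k. b ^ Q * c" "(*) :: 'k \<Rightarrow> 'k \<Rightarrow> 'k" ..
  have "vs.independent {1}" by simp
  from pair.linear_independent_extend[OF this, of "\<lambda>x. x"] obtain \<tau>
    where lin: "Vector_Spaces.linear (\<lambda>b c :: 'k. b ^ Q * c) (*) \<tau>" and "\<tau> 1 = 1" by auto
  then show ?thesis
    using that pair.linear_add[OF lin] pair.linear_scale[OF lin] by metis
qed

text \<open>With \<open>\<tau>\<close> as in \<open>root_form_exists\<close> this splits Frobenius:
  \<open>Q\<close>-th powers come out as their roots, and monomials that are not \<open>Q\<close>-th
  powers up to a scalar are killed.\<close>

definition cartier :: "nat \<Rightarrow> ('k \<Rightarrow> 'k) \<Rightarrow> 'k::field mpol \<Rightarrow> 'k mpol"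
  where "cartier Q \<tau> = mono_ext
    (\<lambda>s c. if emod Q s = 0 then Poly_Mapping.single (ediv Q s) (\<tau> c) else 0)"

lemma cartier_poly_ring: "g \<in> poly_ring d \<Longrightarrow> cartier Q \<tau> g \<in> poly_ring d"
  unfolding cartier_def
  by (rule mono_ext_poly_ring) (auto intro!: poly_ring_single dest!: subsetD[OF keys_ediv])

lemma cartier_0 [simp]: "cartier Q \<tau> 0 = 0"
  by (simp add: cartier_def mono_ext_def)

context
  fixes Q j :: nat and \<tau> :: "'k::field \<Rightarrow> 'k"
  assumes CHAR_pos: "CHAR('k) > 0" and Q: "Q = CHAR('k) ^ j"
    and \<tau>: "\<And>b c. \<tau> (b + c) = \<tau> b + \<tau> c" "\<And>b c. \<tau> (b ^ Q * c) = b * \<tau> c" "\<tau> 1 = 1"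
begin

lemma cartier_add: "cartier Q \<tau> (g + h) = cartier Q \<tau> g + cartier Q \<tau> h"
  unfolding cartier_def by (subst mono_ext_add) (simp_all add: single_add \<tau>)

lemma cartier_single: "cartier Q \<tau> (Poly_Mapping.single s c) =
    (if emod Q s = 0 then Poly_Mapping.single (ediv Q s) (\<tau> c) else 0)"
  unfolding cartier_def by (subst mono_ext_single) (simp_all add: single_add \<tau>)

lemma cartier_power_mult: "cartier Q \<tau> (h ^ Q * g) = h * cartier Q \<tau> g"
proof -
  have Q0: "Q > 0" using Q CHAR_pos by simp
  show ?thesis
  proof (induction h rule: mpol_induct)
    case (add g h)
    have "(g + h) ^ Q = g ^ Q + h ^ Q" by (simp only: Q Frobenius_add[OF CHAR_pos])
    then show ?case using add by (simp add: distrib_right cartier_add)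
  next
    case (single s c)
    show ?case
    proof (induction g rule: mpol_induct)
      case (add g h)
      then show ?case by (simp add: cartier_add distrib_left)
    next
      case (single s' c')
      then show ?case using Q0
        by (simp add: single_power mult_single cartier_single emod_escale_add ediv_escale_add \<tau>)
    qed
  qed
qed

lemma cartier_power: "cartier Q \<tau> (h ^ Q) = h"
proof -
  have "emod Q 0 = 0" "ediv Q 0 = 0" by (auto intro: poly_mapping_eqI)
  then have "cartier Q \<tau> 1 = 1" using cartier_single[of 0 1] \<tau> by simp
  then show ?thesis using cartier_power_mult[of h 1] by simp
qed

text \<open>Each generator is zero or the \<open>Q\<close>-th power of a coefficient of
  \<open>g\<close>. In the latter case \<open>cartier\<close> pulls out that coefficient and leaves
  \<open>cartier Q \<tau> r\<close> as its multiplier.\<close>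

lemma cartier_coef_ideal:
  assumes "x \<in> coef_ideal d (Q * q) (g ^ Q)"
  shows "cartier Q \<tau> x \<in> coef_ideal d q g"
  using assms
proof (induction x rule: coef_ideal.induct)
  case (step x r b)
  show ?case
  proof (cases "\<exists>a. b = escale Q a")
    case True
    then obtain a where "b = escale Q a" by blast
    then have "cartier Q \<tau> (x + r * coef (Q * q) b (g ^ Q)) =
        cartier Q \<tau> x + cartier Q \<tau> r * coef q a g"
      by (simp only: cartier_add coef_Frobenius[OF CHAR_pos Q] mult.commute[of r]
          cartier_power_mult mult.commute[of "coef q a g"])
    then show ?thesis using step by (auto intro: coef_ideal.step cartier_poly_ring)
  next
    case False
    then have "coef (Q * q) b (g ^ Q) = 0" using coef_Frobenius_eq_0[OF CHAR_pos Q] by blast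
    then show ?thesis using step by simp
  qed
qed (simp add: coef_ideal.zero)

end

lemma coef_ideal_Frobenius_descent:
  fixes g h :: "'k::field mpol"
  assumes "CHAR('k) > 0" "Q = CHAR('k) ^ j" "h ^ Q \<in> coef_ideal d (Q * q) (g ^ Q)"
  shows "h \<in> coef_ideal d q g"
proof -
  obtain \<tau> :: "'k \<Rightarrow> 'k" where \<tau>: "\<And>b c. \<tau> (b + c) = \<tau> b + \<tau> c"
    "\<And>b c. \<tau> (b ^ Q * c) = b * \<tau> c" "\<tau> 1 = 1" using root_form_exists[OF assms(1,2)] by metis
  show ?thesis
    using cartier_coef_ideal[OF assms(1,2) \<tau> assms(3)] cartier_power[OF assms(1,2) \<tau>] by simp
qed

section \<open>Coefficients as values of differential operators\<close>

lemma diff_submodule_mult: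
  assumes f: "f \<in> poly_ring d" "f \<noteq> 0" and N: "diff_submodule d f N"
    and "m \<in> N" "r \<in> poly_ring d"
  shows "embed r * m \<in> N"
proof -
  have "m \<in> localization d f" using N assms by (auto simp: diff_submodule_def)
  then have "diff_action d f (on_ring d ((*) r)) m = embed r * m"
    by (rule natural_actionD(6)[OF natural_action_diff_action[OF f] assms(5)])
  moreover have "diff_action d f (on_ring d ((*) r)) m \<in> N"
    using N assms diff_ops.mult[OF assms(5)] by (simp add: diff_submodule_def)
  ultimately show ?thesis by simp
qed

context
  fixes q e :: nat
  assumes CHAR_pos: "CHAR('k::field) > 0" and q: "q = CHAR('k) ^ e"
begin

text \<open>Since \<open>q\<close> divides \<open>a\<close> times the binomial coefficient, a
  coefficient prime to the characteristic would force \<open>q\<close> to divide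
  \<open>a\<close>.\<close>

lemma binomial_mult_q_eq_0:
  assumes "0 < a" "a < q"
  shows "of_nat (q * w choose a) = (0 :: 'k)"
proof -
  let ?B = "q * w choose a"
  have "CHAR('k) dvd ?B"
  proof (rule ccontr)
    assume "\<not> CHAR('k) dvd ?B"
    then have "coprime q ?B" unfolding q
      using prime_CHAR[OF CHAR_pos] by (simp add: prime_imp_coprime)
    moreover have "q dvd a * ?B"
      using assms by (simp add: times_binomial_minus1_eq)
    ultimately have "q dvd a" by (simp add: coprime_dvd_mult_left_iff)
    then show False using assms by (simp add: nat_dvd_not_less)
  qed
  then show ?thesis by (simp add: of_nat_eq_0_iff_char_dvd)
qed

text \<open>Vandermonde for \<open>n = q * (n div q) + n mod q\<close>: by the previous lemma only
  the term with \<open>a = 0\<close> survives.\<close>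

lemma binomial_pred_q:
  "of_nat (n choose (q - 1)) = (if n mod q = q - 1 then 1 else 0 :: 'k)"
proof -
  have q0: "q > 0" using q CHAR_pos by simp
  have "(\<Sum>a\<le>q-1. of_nat (q * (n div q) choose a) * of_nat (n mod q choose (q - 1 - a))) =
      (\<Sum>a\<in>{0}. of_nat (q * (n div q) choose a) * (of_nat (n mod q choose (q - 1 - a)) :: 'k))"
    using q0 by (intro sum.mono_neutral_right) (auto simp: binomial_mult_q_eq_0)
  then have "of_nat (n choose (q - 1)) = (of_nat (n mod q choose (q - 1)) :: 'k)"
    using vandermonde[of "q * (n div q)" "n mod q" "q - 1"]
    by (simp flip: of_nat_mult of_nat_sum)
  moreover have "n mod q < q" using q0 by simp
  ultimately show ?thesis by (auto simp: binomial_eq_0)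
qed

lemma hasse_power_q_eq_0:
  fixes h :: "'k mpol"
  assumes "0 < a" "a < q"
  shows "hasse a i (h ^ q) = 0"
proof (induction h rule: mpol_induct)
  case (add g h)
  then show ?case by (simp add: q Frobenius_add[OF CHAR_pos] hasse_add)
next
  case (single s c)
  then show ?case using binomial_mult_q_eq_0[OF assms] by (simp add: single_power hasse_single)
qed

text \<open>The operator of order \<open>q - 1\<close> detects exactly the exponents with remainder
  \<open>q - 1\<close>; the monomial factor first shifts remainder \<open>n\<close> to that
  value.\<close>

definition coef_var :: "nat \<Rightarrow> nat \<Rightarrow> 'k mpol \<Rightarrow> 'k mpol"
  where "coef_var i n g = hasse (q - 1) i (Poly_Mapping.single (Poly_Mapping.single i (q - 1 - n)) 1 * g)"

lemma coef_var_0: "coef_var i n 0 = 0"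
  by (simp add: coef_var_def)

lemma coef_var_single:
  assumes "n < q"
  shows "coef_var i n (Poly_Mapping.single s c) =
    (if Poly_Mapping.lookup s i mod q = n then Poly_Mapping.single (s - Poly_Mapping.single i n) c else 0)"
proof -
  let ?m = "Poly_Mapping.lookup s i" and ?e = "Poly_Mapping.single i"
  have "(?m + (q - 1 - n)) mod q = q - 1 \<longleftrightarrow> ?m mod q = n"
  proof -
    let ?r = "?m mod q"
    have "?r < q" using assms by simp
    have "(?r + (q - 1 - n)) mod q = q - 1 \<longleftrightarrow> ?r = n"
    proof (cases "?r \<le> n")
      case True
      then have "(?r + (q - 1 - n)) mod q = ?r + (q - 1 - n)" using assms by (intro mod_less) simp
      then show ?thesis using True assms by auto
    next
      case False
      \<comment> \<open>For \<open>?r > n\<close> the sum wraps around to a remainder strictly below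
        \<open>q - 1\<close>, so nothing is detected.\<close>
      then have "?r + (q - 1 - n) = q + (?r - n - 1)" using assms by simp
      then have "(?r + (q - 1 - n)) mod q = (?r - n - 1) mod q"
        by (simp only: mod_add_self1)
      moreover have "?r - n - 1 < q" using \<open>?r < q\<close> by linarith
      ultimately have "(?r + (q - 1 - n)) mod q = ?r - n - 1" by (simp only: mod_less)
      then show ?thesis using False \<open>?r < q\<close> by auto
    qed
    then show ?thesis by (simp only: mod_add_left_eq)
  qed
  moreover have "?e (q - 1 - n) + s - ?e (q - 1) = s - ?e n" if "?m mod q = n"
  proof -
    have "n \<le> ?m" using that mod_less_eq_dividend by blast
    then show ?thesis using assms
      by (intro poly_mapping_eqI) (auto simp: lookup_minus lookup_add lookup_single when_def)
  qed
  ultimately have "of_nat (q - 1 - n + ?m choose (q - 1)) = (if ?m mod q = n then 1 else 0 :: 'k)"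
    and "?m mod q = n \<Longrightarrow> ?e (q - 1 - n) + s - ?e (q - 1) = s - ?e n"
    by (simp_all only: binomial_pred_q add.commute[of "q - 1 - n"])
  then show ?thesis
    by (simp only: coef_var_def mult_single hasse_single lookup_add lookup_single_eq) auto
qed

fun coef_vars :: "(nat \<Rightarrow>\<^sub>0 nat) \<Rightarrow> nat \<Rightarrow> 'k mpol \<Rightarrow> 'k mpol" where
  "coef_vars a 0 g = g"
| "coef_vars a (Suc i) g = coef_var i (Poly_Mapping.lookup a i) (coef_vars a i g)"

lemma coef_vars_add: "coef_vars a n (g + h) = coef_vars a n g + coef_vars a n h"
  by (induction n) (simp_all add: coef_var_def hasse_add distrib_left)

lemma coef_vars_0: "coef_vars a n 0 = 0"
  by (induction n) (simp_all add: coef_var_0)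

lemma coef_vars_single:
  assumes "\<And>i. Poly_Mapping.lookup a i < q"
  shows "coef_vars a n (Poly_Mapping.single s c) =
    (if \<forall>i<n. Poly_Mapping.lookup s i mod q = Poly_Mapping.lookup a i
     then Poly_Mapping.single (s - (\<Sum>i<n. Poly_Mapping.single i (Poly_Mapping.lookup a i))) c else 0)"
proof (induction n)
  case (Suc n)
  \<comment> \<open>The earlier steps changed only exponents of variables below \<open>n\<close>, so
    the test for variable \<open>n\<close> still sees the exponent of \<open>s\<close>.\<close>
  have "Poly_Mapping.lookup (\<Sum>i<n. Poly_Mapping.single i (Poly_Mapping.lookup a i)) n = 0"
    by (simp add: lookup_sum lookup_single when_def)
  then show ?case using Suc assms
    by (auto simp: coef_var_single lookup_minus diff_diff_add less_Suc_eq coef_var_0)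
qed simp

text \<open>Variables from \<open>d\<close> on occur neither in \<open>g\<close> nor in
  \<open>a\<close>, so remainders in the first \<open>d\<close> variables decide whether
  \<open>emod q s = a\<close>.\<close>

lemma coef_vars_eq_coef:
  assumes "g \<in> poly_ring d" and a: "Poly_Mapping.keys a \<subseteq> {..<d}" "\<And>i. Poly_Mapping.lookup a i < q"
  shows "coef_vars a d g = coef q a g"
proof -
  have "Poly_Mapping.keys g \<subseteq> {s. Poly_Mapping.keys s \<subseteq> {..<d}}"
    using assms(1) by (auto simp: poly_ring_def)
  then show ?thesis
  proof (induction g rule: mpol_keys_induct)
    case (single s c)
    have "(\<Sum>i<d. Poly_Mapping.single i (Poly_Mapping.lookup a i)) = a"
      by (rule poly_mapping_eqI) (use a(1) in \<open>auto simp: lookup_sum lookup_single when_def in_keys_iff\<close>)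
    moreover have "emod q s = a \<longleftrightarrow> (\<forall>i<d. Poly_Mapping.lookup s i mod q = Poly_Mapping.lookup a i)"
    proof -
      have "Poly_Mapping.lookup s i = 0 \<and> Poly_Mapping.lookup a i = 0" if "\<not> i < d" for i
        using single a(1) that by (auto simp: in_keys_iff subset_iff)
      then show ?thesis
        by (auto simp: poly_mapping_eq_iff fun_eq_iff) (metis mod_0)
    qed
    moreover have "s - a = escale q (ediv q s)" if "emod q s = a"
      using emod_plus_escale_ediv[of q s] that by (metis add_diff_cancel_left')
    ultimately show ?case using a(2) by (auto simp: coef_vars_single coef_single)
  qed (simp_all add: coef_vars_0 coef_vars_add coef_add)
qed

lemma coef_eq_0:
  fixes g :: "'k mpol"
  assumes "g \<in> poly_ring d" "\<not> (Poly_Mapping.keys a \<subseteq> {..<d} \<and> (\<forall>i. Poly_Mapping.lookup a i < q))"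
  shows "coef q a g = 0"
proof -
  have "emod q s \<noteq> a" if "s \<in> Poly_Mapping.keys g" for s
  proof -
    have "Poly_Mapping.keys s \<subseteq> {..<d}" using assms(1) that by (auto simp: poly_ring_def)
    moreover have "Poly_Mapping.lookup (emod q s) i < q" for i using q CHAR_pos by simp
    ultimately show ?thesis using assms(2) keys_emod[of q s] by blast
  qed
  then show ?thesis unfolding coef_def mono_ext_def by (auto intro: sum.neutral)
qed

context
  fixes d :: nat and f :: "'k mpol" and N :: "'k mpol fract set"
  assumes f: "f \<in> poly_ring d" "f \<noteq> 0" and N: "diff_submodule d f N"
begin

text \<open>Operators of order below \<open>q\<close> commute with multiplication by \<open>f^q\<close>.\<close>

lemma diff_submodule_hasse:
  assumes x: "x \<in> poly_ring d" "embed x / embed f ^ q \<in> N" and "i < d" "t < q"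
  shows "embed (hasse t i x) / embed f ^ q \<in> N"
proof -
  let ?m = "embed x / embed f ^ q"
  let ?D = "\<lambda>t. diff_action d f (on_ring d (hasse t i))"
  note act = natural_actionD[OF natural_action_diff_action[OF f]]
  have nz: "embed f ^ q \<noteq> 0" using f by (simp add: embed_eq_0_iff)
  have m: "?m \<in> localization d f" using N x by (auto simp: diff_submodule_def)
  have fq: "f ^ q \<in> poly_ring d" using f by (intro poly_ring_power)
  have emb: "?D t (embed g) = embed (hasse t i g)" if "g \<in> poly_ring d" for g t
    using act(5)[OF diff_ops.hasse[OF \<open>i < d\<close>] that, of t] that by (simp add: on_ring_def)
  \<comment> \<open>The product \<open>f^q * ?m\<close> lies in the polynomial ring, where the
    action is known. In its Leibniz expansion the terms with \<open>0 < a \<le> t\<close> vanish by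
    \<open>hasse_power_q_eq_0\<close>.\<close>
  have "embed (hasse t i x) = ?D t (embed (f ^ q) * ?m)"
    using nz x(1) by (simp add: emb embed_power)
  also have "\<dots> = (\<Sum>a\<le>t. ?D a (embed (f ^ q)) * ?D (t - a) ?m)"
    by (rule act(7)) (use embed_localization[OF f fq] m assms in auto)
  also have "\<dots> = (\<Sum>a\<in>{0}. ?D a (embed (f ^ q)) * ?D (t - a) ?m)"
    using \<open>t < q\<close> by (intro sum.mono_neutral_right) (auto simp: emb[OF fq] hasse_power_q_eq_0 embed_0)
  also have "\<dots> = embed f ^ q * ?D t ?m"
    using emb[OF fq, of 0] by (simp add: hasse_order_0 embed_power)
  finally have "embed (hasse t i x) / embed f ^ q = ?D t ?m" using nz by (simp add: field_simps)
  moreover have "?D t ?m \<in> N"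
    using N x diff_ops.hasse[OF \<open>i < d\<close>, of t] unfolding diff_submodule_def by blast
  ultimately show ?thesis by simp
qed

lemma diff_submodule_coef:
  assumes x: "x \<in> poly_ring d" "embed x / embed f ^ q \<in> N"
  shows "embed (coef q a x) / embed f ^ q \<in> N"
proof (cases "Poly_Mapping.keys a \<subseteq> {..<d} \<and> (\<forall>i. Poly_Mapping.lookup a i < q)")
  case False
  then have "coef q a x = 0" by (rule coef_eq_0[OF x(1)])
  then show ?thesis using N by (simp add: embed_0 diff_submodule_def)
next
  case True
  have q0: "q > 0" using q CHAR_pos by simp
  have "coef_vars a n x \<in> poly_ring d \<and> embed (coef_vars a n x) / embed f ^ q \<in> N" if "n \<le> d" for n
    using that
  proof (induction n)
    case (Suc n)
    let ?r = "Poly_Mapping.single (Poly_Mapping.single n (q - 1 - Poly_Mapping.lookup a n)) 1 :: 'k mpol"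
    have r: "?r \<in> poly_ring d" using Suc.prems by (intro poly_ring_single) auto
    have "embed ?r * (embed (coef_vars a n x) / embed f ^ q) \<in> N"
      using Suc r by (intro diff_submodule_mult[OF f N]) auto
    then have "embed (?r * coef_vars a n x) / embed f ^ q \<in> N" by (simp add: embed_mult)
    then show ?case using Suc r q0
      by (auto simp: coef_var_def intro!: diff_submodule_hasse hasse_closed poly_ring_mult)
  qed (use x in simp)
  from this[of d] show ?thesis using True x(1) by (simp add: coef_vars_eq_coef)
qed

lemma coef_ideal_subset_diff_submodule:
  assumes x: "x \<in> poly_ring d" "embed x / embed f ^ q \<in> N" and "y \<in> coef_ideal d q x"
  shows "embed y / embed f ^ q \<in> N"
  using assms(3)
proof (induction y rule: coef_ideal.induct)
  case zero
  then show ?case using N by (simp add: embed_0 diff_submodule_def)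
next
  case (step y r a)
  have "embed r * (embed (coef q a x) / embed f ^ q) \<in> N"
    by (intro diff_submodule_mult[OF f N] diff_submodule_coef x step)
  then have "embed y / embed f ^ q + embed r * (embed (coef q a x) / embed f ^ q) \<in> N"
    using N step by (simp add: diff_submodule_def)
  then show ?case by (simp add: embed_add embed_mult add_divide_distrib)
qed

end

end

section \<open>Stabilization\<close>

lemma finite_bounded_exponents:
  "finite {w :: nat \<Rightarrow>\<^sub>0 nat. Poly_Mapping.keys w \<subseteq> {..<d} \<and> (\<forall>i. Poly_Mapping.lookup w i \<le> D)}"
  (is "finite ?E")
proof (rule finite_imageD)
  show "finite (Poly_Mapping.lookup ` ?E)"
  proof (rule finite_subset)
    show "Poly_Mapping.lookup ` ?E \<subseteq>
        {h. \<forall>i. (i \<in> {..<d} \<longrightarrow> h i \<in> {..D}) \<and> (i \<notin> {..<d} \<longrightarrow> h i = 0)}"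
      by (auto simp: in_keys_iff subset_iff)
  qed (rule finite_set_of_finite_funs; simp)
  show "inj_on Poly_Mapping.lookup ?E" by (auto intro: inj_onI poly_mapping_eqI)
qed

lemma lookup_keys_power_le:
  assumes "\<And>s. s \<in> Poly_Mapping.keys f \<Longrightarrow> Poly_Mapping.lookup s i \<le> D"
    and "s \<in> Poly_Mapping.keys (f ^ n)"
  shows "Poly_Mapping.lookup s i \<le> n * D"
  using assms(2)
proof (induction n arbitrary: s)
  case (Suc n)
  then obtain u v where "s = u + v" "u \<in> Poly_Mapping.keys f" "v \<in> Poly_Mapping.keys (f ^ n)"
    using keys_mult[of f "f ^ n"] by auto
  then show ?case using assms(1)[of u] Suc.IH[of v] by (simp add: lookup_add)
qed simp

lemma exponent_bound:
  fixes f :: "'k::field mpol"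
  shows "\<exists>D. \<forall>s\<in>Poly_Mapping.keys f. \<forall>i. Poly_Mapping.lookup s i \<le> D"
proof (intro exI ballI allI)
  fix s i assume s: "s \<in> Poly_Mapping.keys f"
  have "Poly_Mapping.lookup s i \<le> (\<Sum>i\<in>Poly_Mapping.keys s. Poly_Mapping.lookup s i)"
    by (cases "i \<in> Poly_Mapping.keys s") (auto simp: in_keys_iff intro: member_le_sum)
  also have "\<dots> \<le> (\<Sum>s\<in>Poly_Mapping.keys f. \<Sum>i\<in>Poly_Mapping.keys s. Poly_Mapping.lookup s i)"
    using s by (intro member_le_sum) auto
  finally show "Poly_Mapping.lookup s i \<le> \<dots>" .
qed

text \<open>Scalars act as constant polynomials, which makes every \<open>coef_ideal\<close> a
  subspace and lets dimension replace a Noetherian argument.\<close>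

interpretation mpol: vector_space "\<lambda>(c :: 'k::field) (g :: 'k mpol). Poly_Mapping.single 0 c * g"
  by unfold_locales
     (simp_all add: distrib_left distrib_right mult_single single_add flip: mult.assoc)

lemma mpol_in_span:
  "Poly_Mapping.keys g \<subseteq> A \<Longrightarrow> g \<in> mpol.span ((\<lambda>s. Poly_Mapping.single s 1) ` A)"
proof (induction g rule: mpol_keys_induct)
  case (single s c)
  then have "Poly_Mapping.single 0 c * Poly_Mapping.single s 1 \<in>
      mpol.span ((\<lambda>s. Poly_Mapping.single s 1) ` A)"
    by (intro mpol.span_scale mpol.span_base) auto
  then show ?case by (simp add: mult_single)
qed (auto intro: mpol.span_zero mpol.span_add)

lemma coef_ideal_subspace: "mpol.subspace (coef_ideal d q g)"
  by (rule mpol.subspaceI)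
     (simp_all add: coef_ideal.zero coef_ideal_add coef_ideal_mult poly_ring_single)

text \<open>
  In a strictly increasing chain one could choose \<open>k\<close>-linearly independent coefficients of powers of
  \<open>f\<close>.  The coefficients of \<open>f^n\<close> for \<open>n \<le> q\<close> all lie in a \<open>k\<close>-vector space whose dimension does
  not depend on \<open>q\<close>.
\<close>

lemma coef_ideal_stabilizes:
  fixes f :: "'k::field mpol"
  assumes "p > 0" and f: "f \<in> poly_ring d"
  obtains j L where "j < L" "f ^ (p ^ L - p ^ Suc j) \<in> coef_ideal d (p ^ L) (f ^ (p ^ L - p ^ j))"
proof -
  obtain D where D: "\<And>s i. s \<in> Poly_Mapping.keys f \<Longrightarrow> Poly_Mapping.lookup s i \<le> D"
    using exponent_bound[of f] by blast
  define E where "E = {w :: nat \<Rightarrow>\<^sub>0 nat.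
    Poly_Mapping.keys w \<subseteq> {..<d} \<and> (\<forall>i. Poly_Mapping.lookup w i \<le> D)}"
  have E: "finite E" unfolding E_def by (rule finite_bounded_exponents)
  \<comment> \<open>\<open>E\<close> depends only on \<open>f\<close> and \<open>d\<close>, so
    \<open>L\<close> can be fixed before \<open>q\<close>; it exceeds the dimension of the span of
    \<open>?T\<close>.\<close>
  define L where "L = Suc (card E)"
  define q where "q = p ^ L"
  have q0: "q > 0" using \<open>p > 0\<close> by (simp add: q_def)
  define J where "J j = coef_ideal d q (f ^ (q - p ^ j))" for j
  let ?T = "(\<lambda>s. Poly_Mapping.single s (1 :: 'k)) ` escale q ` E"
  \<comment> \<open>Exponents in \<open>f ^ n\<close> are at most \<open>q * D\<close>, so their
    quotients by \<open>q\<close> are at most \<open>D\<close>, whatever \<open>q\<close>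
    is.\<close>
  have span: "coef q a (f ^ n) \<in> mpol.span ?T" if "n \<le> q" for a n
  proof (rule mpol_in_span, rule subsetI)
    fix u assume "u \<in> Poly_Mapping.keys (coef q a (f ^ n))"
    then obtain s where s: "s \<in> Poly_Mapping.keys (f ^ n)" "u = escale q (ediv q s)"
      by (rule keys_coef)
    have "Poly_Mapping.lookup s i div q \<le> D" for i
    proof -
      have "Poly_Mapping.lookup s i \<le> n * D" using lookup_keys_power_le[OF D] s(1) by blast
      also have "\<dots> \<le> q * D" using that by simp
      finally have "Poly_Mapping.lookup s i div q \<le> q * D div q" by (rule div_le_mono)
      then show ?thesis using q0 by simp
    qed
    moreover have "Poly_Mapping.keys (ediv q s) \<subseteq> {..<d}"
      using s(1) poly_ring_power[OF f, of n] keys_ediv[of q s] by (auto simp: poly_ring_def)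
    ultimately show "u \<in> escale q ` E" using s(2) by (auto simp: E_def)
  qed
  have mono: "J j \<subseteq> J (Suc j)" if "j < L" for j
  proof -
    have "p ^ j \<le> p ^ Suc j" "p ^ Suc j \<le> q"
      using \<open>p > 0\<close> that unfolding q_def by (auto intro: power_increasing simp del: power_Suc)
    then have "f ^ (q - p ^ j) = f ^ (p ^ Suc j - p ^ j) * f ^ (q - p ^ Suc j)"
      by (simp flip: power_add)
    then have "f ^ (q - p ^ j) \<in> J (Suc j)"
      using f unfolding J_def by (auto intro!: coef_ideal_mult coef_ideal_self poly_ring_power)
    then show ?thesis unfolding J_def using coef_ideal_subset q0 by blast
  qed
  have "\<exists>j<L. f ^ (q - p ^ Suc j) \<in> J j"
  proof (rule ccontr)
    assume contr: "\<not> ?thesis"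
    \<comment> \<open>A polynomial whose coefficients all lie in \<open>J j\<close> would lie in
      \<open>J j\<close> itself.\<close>
    have "\<exists>a. coef q a (f ^ (q - p ^ Suc j)) \<notin> J j" if "j < L" for j
      using contr that coef_ideal_if_coefs[OF poly_ring_power[OF f]] unfolding J_def by blast
    then obtain a where a: "coef q (a j) (f ^ (q - p ^ Suc j)) \<notin> J j" if "j < L" for j by metis
    define c where "c j = coef q (a j) (f ^ (q - p ^ Suc j))" for j
    \<comment> \<open>The subspace \<open>J n\<close> contains all \<open>c j\<close> with
      \<open>j < n\<close> but not \<open>c n\<close>, so each new element is independent of the
      earlier ones; \<open>c n\<close> lies in \<open>J (Suc n)\<close>.\<close>
    have "mpol.independent (c ` {..<n}) \<and> card (c ` {..<n}) = n \<and> c ` {..<n} \<subseteq> J n" if "n \<le> L" for n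
      using that
    proof (induction n)
      case 0
      then show ?case by (simp add: mpol.independent_empty)
    next
      case (Suc n)
      then have IH: "mpol.independent (c ` {..<n})" "card (c ` {..<n}) = n" "c ` {..<n} \<subseteq> J n"
        by auto
      have "mpol.span (c ` {..<n}) \<subseteq> J n"
        using IH(3) coef_ideal_subspace unfolding J_def by (rule mpol.span_minimal)
      moreover have "c n \<notin> J n" using a Suc.prems by (simp add: c_def)
      ultimately have "c n \<notin> mpol.span (c ` {..<n})" "c n \<notin> c ` {..<n}"
        using mpol.span_superset[of "c ` {..<n}"] by blast+
      moreover have "c n \<in> J (Suc n)" unfolding c_def J_def by (rule coef_ideal_coef)
      ultimately show ?case using IH mono[of n] Suc.prems
        by (auto simp: lessThan_Suc mpol.independent_insertI)
    qed
    from this[of L] have "mpol.independent (c ` {..<L})" "card (c ` {..<L}) = L" by auto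
    moreover have "c ` {..<L} \<subseteq> mpol.span ?T" using span unfolding c_def by auto
    ultimately have "L \<le> card ?T" using mpol.independent_span_bound[of ?T "c ` {..<L}"] E by simp
    also have "\<dots> \<le> card E" using E by (metis card_image_le finite_imageI order_trans)
    finally show False by (simp add: L_def)
  qed
  then show ?thesis using that unfolding J_def q_def by blast
qed

text \<open>Both exponents found by stabilization are multiples of \<open>p^j\<close>, with
  \<open>p\<close> the characteristic, so the membership descends along Frobenius from level
  \<open>p^L\<close> to level \<open>p^(L - j)\<close>.\<close>

lemma root_in_coef_ideal:
  fixes f :: "'k::field mpol"
  assumes CHAR_pos: "CHAR('k) > 0" and f: "f \<in> poly_ring d"
  obtains e where "e > 0"
    "f ^ (CHAR('k) ^ e - CHAR('k)) \<in> coef_ideal d (CHAR('k) ^ e) (f ^ (CHAR('k) ^ e - 1))"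
proof -
  let ?p = "CHAR('k)"
  obtain j L where jL: "j < L" "f ^ (?p ^ L - ?p ^ Suc j) \<in> coef_ideal d (?p ^ L) (f ^ (?p ^ L - ?p ^ j))"
    by (rule coef_ideal_stabilizes[OF CHAR_pos f])
  define e where "e = L - j"
  have "?p ^ L = ?p ^ j * ?p ^ e" using jL(1) by (simp add: e_def flip: power_add)
  moreover have "f ^ (?p ^ j * ?p ^ e - ?p ^ Suc j) = (f ^ (?p ^ e - ?p)) ^ (?p ^ j)"
      "f ^ (?p ^ j * ?p ^ e - ?p ^ j) = (f ^ (?p ^ e - 1)) ^ (?p ^ j)"
    by (simp_all add: diff_mult_distrib diff_mult_distrib2 mult.commute flip: power_mult)
  ultimately have "(f ^ (?p ^ e - ?p)) ^ (?p ^ j) \<in> coef_ideal d (?p ^ j * ?p ^ e) ((f ^ (?p ^ e - 1)) ^ (?p ^ j))"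
    using jL(2) by simp
  then have "f ^ (?p ^ e - ?p) \<in> coef_ideal d (?p ^ e) (f ^ (?p ^ e - 1))"
    by (rule coef_ideal_Frobenius_descent[OF CHAR_pos refl])
  moreover have "e > 0" using jL(1) by (simp add: e_def)
  ultimately show ?thesis using that by blast
qed

section \<open>Generation by \<open>1/f\<close>\<close>

lemma inverse_powers_in_diff_submodule:
  fixes f :: "'k::field mpol"
  assumes CHAR_pos: "CHAR('k) > 0" and f: "f \<in> poly_ring d" "f \<noteq> 0"
    and N: "diff_submodule d f N" "1 / embed f \<in> N"
  shows "1 / embed f ^ (CHAR('k) ^ n) \<in> N"
proof (induction n)
  case 0
  then show ?case using N by simp
next
  case (Suc n)
  let ?p = "CHAR('k)"
  have nz: "embed f \<noteq> 0" using f by (simp add: embed_eq_0_iff)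
  \<comment> \<open>This puts inverse powers of \<open>f\<close> over the common denominator
    \<open>f ^ ?q\<close>, as \<open>coef_ideal_subset_diff_submodule\<close> requires.\<close>
  have quot: "embed (f ^ (b - a)) / embed f ^ b = 1 / embed f ^ a" if "a \<le> b" for a b
    using nz that by (simp add: embed_power power_diff)
  obtain e where e: "e > 0" "f ^ (?p ^ e - ?p) \<in> coef_ideal d (?p ^ e) (f ^ (?p ^ e - 1))"
    by (rule root_in_coef_ideal[OF CHAR_pos f(1)])
  \<comment> \<open>The \<open>p^n\<close>-th power of the membership at level \<open>p^e\<close>
    lives at this level.\<close>
  let ?q = "?p ^ (n + e)"
  have le: "?p ^ n \<le> ?q" "?p ^ Suc n \<le> ?q"
    using CHAR_pos e(1) by (auto intro!: power_increasing simp del: power_Suc)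
  have "(f ^ (?p ^ e - ?p)) ^ (?p ^ n) \<in> coef_ideal d (?p ^ n * ?p ^ e) ((f ^ (?p ^ e - 1)) ^ (?p ^ n))"
    by (rule Frobenius_coef_ideal[OF CHAR_pos refl e(2)])
  moreover have "(f ^ (?p ^ e - ?p)) ^ (?p ^ n) = f ^ (?q - ?p ^ Suc n)"
      "(f ^ (?p ^ e - 1)) ^ (?p ^ n) = f ^ (?q - ?p ^ n)"
    by (simp_all add: diff_mult_distrib diff_mult_distrib2 mult.commute power_add flip: power_mult)
  ultimately have root: "f ^ (?q - ?p ^ Suc n) \<in> coef_ideal d ?q (f ^ (?q - ?p ^ n))"
    by (simp only: power_add)
  have "embed (f ^ (?q - ?p ^ n)) / embed f ^ ?q \<in> N" using Suc by (simp only: quot[OF le(1)])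
  from coef_ideal_subset_diff_submodule[OF CHAR_pos refl f N(1) poly_ring_power[OF f(1)] this root]
  have "embed (f ^ (?q - ?p ^ Suc n)) / embed f ^ ?q \<in> N" .
  then show ?case by (simp only: quot[OF le(2)])
qed

lemma diff_submodule_localization:
  "f \<in> poly_ring d \<Longrightarrow> f \<noteq> 0 \<Longrightarrow> diff_submodule d f (localization d f)"
  using natural_actionD(1)[OF natural_action_diff_action]
  by (auto simp: diff_submodule_def localization_0 localization_add)

theorem theorem1p1:
  fixes p d :: nat and f :: "'k::field mpol"
  assumes "CHAR('k) = p" and "p > 0"
    and "f \<in> poly_ring d" and "f \<noteq> 0"
  shows "generated_submodule d f {Fract 1 f} = localization d f"
proof (rule antisym)
  note f = assms(3,4)
  have "Fract 1 (f ^ 1) \<in> localization d f"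
    unfolding localization_def using poly_ring_1 by blast
  then show "generated_submodule d f {Fract 1 f} \<subseteq> localization d f"
    unfolding generated_submodule_def using diff_submodule_localization[OF f]
    by (intro hull_minimal) auto
  show "localization d f \<subseteq> generated_submodule d f {Fract 1 f}"
    unfolding generated_submodule_def hull_def
  proof (intro subsetI InterI, elim CollectE conjE)
    fix m N assume "m \<in> localization d f" and N: "diff_submodule d f N" "{Fract 1 f} \<subseteq> N"
    then obtain g n where g: "m = Fract g (f ^ n)" "g \<in> poly_ring d"
      by (auto simp: localization_def)
    have nz: "embed f \<noteq> 0" using f by (simp add: embed_eq_0_iff)
    have "1 / embed f \<in> N" using N(2) by (simp add: Fract_conv embed_1)
    then have "1 / embed f ^ (p ^ n) \<in> N"
      using inverse_powers_in_diff_submodule[OF _ f N(1)] assms(1,2) by blast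
    \<comment> \<open>This element is \<open>m\<close> rewritten over the denominator
      \<open>f^(p^n)\<close>, as \<open>n \<le> p ^ n\<close>.\<close>
    then have mem: "embed (g * f ^ (p ^ n - n)) * (1 / embed f ^ (p ^ n)) \<in> N"
      using g(2) f assms(1,2)
      by (intro diff_submodule_mult[OF f N(1)] poly_ring_mult poly_ring_power) auto
    have "n \<le> p ^ n"
    proof -
      have "prime CHAR('k)" by (rule prime_CHAR) (simp add: assms)
      then have "2 \<le> p" using assms(1) prime_ge_2_nat by blast
      then have "2 ^ n \<le> p ^ n" by (rule power_mono) simp
      then show ?thesis using less_exp[of n] by linarith
    qed
    then have "embed (g * f ^ (p ^ n - n)) * (1 / embed f ^ (p ^ n)) = m"
      using nz g(1) by (simp add: embed_mult embed_power power_diff Fract_conv)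
    then show "m \<in> N" using mem by (simp only:)
  qed
qed

end
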